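(* Let $L>0$, let $a\in C^2(\mathbb{R},\mathbb{R})$ be positive and $L$-periodic, and let $f\in C^1(\mathbb{R}^2,\mathbb{R})$ satisfy $f(x+L,u)\equiv f(x,u)$ and $f(x,0)\equiv 0$. Let $q_1,q_2,q$ be $L$-periodic stationary solutions of $\partial_t u=\partial_x(a(x)\partial_x u)+f(x,u)$ with $q_1<q$ and $q_2<q$, and let $U_1$ and $U_2$ be two traveling waves connecting respectively $q_1$ to $q$ and $q_2$ to $q$, with speeds $c_1$ and $c_2$. Assume that there exist $\delta>0$ and an $L$-periodic function $g$ such that $\mu_g\le 0$ and $\partial_u f(x,u)\le g(x)$ for all $x\in\mathbb{R}$ and $u\in[q(x)-\delta,q(x)]$, and that $U_1$ is steeper than $U_2$. Then $c_1\le c_2$. Moreover, if $c_1=c_2\neq 0$, then $U_1\equiv U_2$ up to some time shift.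
   Context: Equation: (E) denotes $\partial_t u=\partial_x(a(x)\partial_x u)+f(x,u)$ for $x\in\mathbb{R}$. A stationary solution is a time-independent solution; an entire solution is a solution defined for all $(t,x)\in\mathbb{R}\times\mathbb{R}$. Inequalities between functions are pointwise. Principal eigenvalue: for an $L$-periodic function $g$, $\mu_g$ is the principal eigenvalue of $\partial_x(a\,\partial_x\phi)+g\phi=\mu_g\phi$ in $\mathbb{R}$, with $\phi>0$ and $L$-periodic. Pulsating traveling waves: for $L$-periodic stationary solutions $r,q$ of (E), a (pulsating) traveling wave connecting $r$ to $q$ with speed $c\in\mathbb{R}$ is an entire solution of the form $u(t,x)=U(x-ct,x)$, where $U(z,x)$ is $L$-periodic in $x$ and satisfies $U(+\infty,\cdot)=r(\cdot)$, $U(-\infty,\cdot)=q(\cdot)$ (so $r$ is the limit on the right and $q$ the limit on the left). The waves $U_1,U_2$ are regarded as entire solutions $U_i(t,x)$. Steepness: $u_1(t,x)$ is steeper than $u_2(t,x)$ if for all $x_1,t_1,t_2\in\mathbb{R}$, $u_1(t_1,x_1)=u_2(t_2,x_1)$ implies $u_1(t_1,x)\ge u_2(t_2,x)$ for all $x\le x_1$ and $u_1(t_1,x)\le u_2(t_2,x)$ for all $x\ge x_1$.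
   Formalization: The formal theorem additionally assumes U_1 ≤ q; without it the statement fails, since a wave U_1 overshooting q on the left can be steeper than U_2 and yet have c_1 > c_2. *)

theory Defs
  imports "HOL-Analysis.Analysis" "HOL-Library.Periodic_Fun"
begin

definition C2_real :: "(real \<Rightarrow> real) \<Rightarrow> bool" where
  "C2_real h \<longleftrightarrow> h C1_differentiable_on UNIV \<and> deriv h C1_differentiable_on UNIV"

definition C1_plane :: "(real \<Rightarrow> real \<Rightarrow> real) \<Rightarrow> bool" where
  "C1_plane f \<longleftrightarrow>
     (\<exists>D :: real \<times> real \<Rightarrow> (real \<times> real) \<Rightarrow>\<^sub>L real.
        (\<forall>p. ((\<lambda>(x, u). f x u) has_derivative blinfun_apply (D p)) (at p)) \<and>
        continuous_on UNIV D)"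

(* Classical (C^1 in t, C^2 in x) solutions of u_t = (a u_x)_x + f(x,u) on all of R x R.
   Arguments are ordered u t x. *)
definition entire_solution ::
  "(real \<Rightarrow> real) \<Rightarrow> (real \<Rightarrow> real \<Rightarrow> real) \<Rightarrow> (real \<Rightarrow> real \<Rightarrow> real) \<Rightarrow> bool" where
  "entire_solution a f u \<longleftrightarrow>
     (\<forall>x. (\<lambda>t. u t x) C1_differentiable_on UNIV) \<and>
     (\<forall>t. C2_real (u t)) \<and>
     continuous_on UNIV (\<lambda>(t, x). deriv (\<lambda>s. u s x) t) \<and>
     continuous_on UNIV (\<lambda>(t, x). deriv (u t) x) \<and>
     continuous_on UNIV (\<lambda>(t, x). deriv (deriv (u t)) x) \<and>
     (\<forall>t x. deriv (\<lambda>s. u s x) t = deriv (\<lambda>y. a y * deriv (u t) y) x + f x (u t x))"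

definition stationary_solution ::
  "(real \<Rightarrow> real) \<Rightarrow> (real \<Rightarrow> real \<Rightarrow> real) \<Rightarrow> (real \<Rightarrow> real) \<Rightarrow> bool" where
  "stationary_solution a f q \<longleftrightarrow> entire_solution a f (\<lambda>t. q)"

(* The principal eigenvalue is the (unique) mu admitting a positive L-periodic eigenfunction;
   it is rendered as a relation between g and mu. *)
definition principal_eigenvalue ::
  "(real \<Rightarrow> real) \<Rightarrow> real \<Rightarrow> (real \<Rightarrow> real) \<Rightarrow> real \<Rightarrow> bool" where
  "principal_eigenvalue a L g \<mu> \<longleftrightarrow>
     (\<exists>\<phi>. C2_real \<phi> \<and> periodic_fun_simple \<phi> L \<and> (\<forall>x. 0 < \<phi> x) \<and>
        (\<forall>x. deriv (\<lambda>y. a y * deriv \<phi> y) x + g x * \<phi> x = \<mu> * \<phi> x))"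

(* r is the limit on the right, q the limit on the left; both limits are uniform in x.
   No regularity is asked of the profile U itself. *)
definition traveling_wave ::
  "(real \<Rightarrow> real) \<Rightarrow> (real \<Rightarrow> real \<Rightarrow> real) \<Rightarrow> real \<Rightarrow> (real \<Rightarrow> real) \<Rightarrow> (real \<Rightarrow> real) \<Rightarrow> real
     \<Rightarrow> (real \<Rightarrow> real \<Rightarrow> real) \<Rightarrow> bool" where
  "traveling_wave a f L r q c u \<longleftrightarrow>
     entire_solution a f u \<and>
     (\<exists>U. (\<forall>t x. u t x = U (x - c * t) x) \<and>
          (\<forall>z. periodic_fun_simple (U z) L) \<and>
          uniform_limit UNIV U r at_top \<and>
          uniform_limit UNIV U q at_bot)"

definition steeper :: "(real \<Rightarrow> real \<Rightarrow> real) \<Rightarrow> (real \<Rightarrow> real \<Rightarrow> real) \<Rightarrow> bool" where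
  "steeper u\<^sub>1 u\<^sub>2 \<longleftrightarrow>
     (\<forall>x\<^sub>1 t\<^sub>1 t\<^sub>2. u\<^sub>1 t\<^sub>1 x\<^sub>1 = u\<^sub>2 t\<^sub>2 x\<^sub>1 \<longrightarrow>
        (\<forall>x\<le>x\<^sub>1. u\<^sub>1 t\<^sub>1 x \<ge> u\<^sub>2 t\<^sub>2 x) \<and> (\<forall>x\<ge>x\<^sub>1. u\<^sub>1 t\<^sub>1 x \<le> u\<^sub>2 t\<^sub>2 x))"

end

theory Submission
  imports Defs
begin

text \<open>
  Compare the time shift \<open>U\<^sub>1 (t + s)\<close> with \<open>U\<^sub>2 t\<close>, and let \<open>c\<^sub>2 t + b\<close> be a moving point to
  the left of which \<open>U\<^sub>2\<close> is within \<open>\<delta>\<close> of \<open>q\<close>. If \<open>U\<^sub>1 (t + s) < U\<^sub>2 t\<close> at the moving point, then the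
  same order holds to its left, by a maximum principle based on the principal eigenfunction, and
  to its right, by steepness. So the order of the two waves is decided by its sign at the moving
  point. Let \<open>U\<^sub>1\<close> start behind \<open>U\<^sub>2\<close> and consider the first contact at the moving point: in time
  if \<open>c\<^sub>1 > c\<^sub>2\<close>, in the shift \<open>s\<close> if \<open>c\<^sub>1 = c\<^sub>2 \<noteq> 0\<close>. By the strong maximum principle the two solutions
  agree before the contact. This is absurd in the first case, and in the second it extends to all
  times because the waves are invariant under the translation by \<open>(L / c\<^sub>2, L)\<close>.
\<close>

section \<open>Classical solutions\<close>

text \<open>The divergence term is expanded and no continuity is asked of the derivatives: the
  comparison arguments evaluate the equation only at a touching point, and the only other regularity
  they use is joint continuity of \<open>u\<close>.\<close>

definition classical_sol ::
  "(real \<Rightarrow> real) \<Rightarrow> (real \<Rightarrow> real \<Rightarrow> real) \<Rightarrow> (real \<Rightarrow> real \<Rightarrow> real) \<Rightarrow> bool" where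
  "classical_sol a f u \<longleftrightarrow> continuous_on UNIV (\<lambda>(t, x). u t x) \<and>
     (\<exists>ut ux uxx. \<forall>t x. ((\<lambda>s. u s x) has_real_derivative ut t x) (at t) \<and>
        (u t has_real_derivative ux t x) (at x) \<and>
        (ux t has_real_derivative uxx t x) (at x) \<and>
        ut t x = a x * uxx t x + deriv a x * ux t x + f x (u t x))"

lemma continuous_on_classical_sol:
  assumes "classical_sol a f u" "continuous_on S \<sigma>" "continuous_on S \<xi>"
  shows "continuous_on S (\<lambda>p. u (\<sigma> p) (\<xi> p))"
proof -
  have "continuous_on UNIV (\<lambda>p. u (fst p) (snd p))"
    using assms(1) by (simp add: classical_sol_def case_prod_unfold)
  from continuous_on_compose2[OF this continuous_on_Pair[OF assms(2,3)]] show ?thesis by simp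
qed

lemma C1_differentiable_on_UNIV_real:
  fixes h :: "real \<Rightarrow> real"
  assumes "h C1_differentiable_on UNIV"
  shows "(h has_real_derivative deriv h x) (at x)" "continuous_on UNIV (deriv h)"
proof -
  obtain D where D: "\<And>x. (h has_vector_derivative D x) (at x)" "continuous_on UNIV D"
    using assms unfolding C1_differentiable_on_def by auto
  have D': "(h has_real_derivative D x) (at x)" for x
    using D(1) by (simp add: has_real_derivative_iff_has_vector_derivative)
  then have "deriv h = D"
    using DERIV_imp_deriv by blast
  with D D' show "(h has_real_derivative deriv h x) (at x)" "continuous_on UNIV (deriv h)"
    by auto
qed

lemma C2_realD:
  assumes "C2_real h"
  shows "(h has_real_derivative deriv h x) (at x)"
    "(deriv h has_real_derivative deriv (deriv h) x) (at x)"
    "continuous_on UNIV h" "continuous_on UNIV (deriv h)"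
proof -
  show *: "(h has_real_derivative deriv h x) (at x)" for x
    using assms C1_differentiable_on_UNIV_real unfolding C2_real_def by blast
  show **: "(deriv h has_real_derivative deriv (deriv h) x) (at x)" for x
    using assms C1_differentiable_on_UNIV_real unfolding C2_real_def by blast
  show "continuous_on UNIV h" "continuous_on UNIV (deriv h)"
    by (intro continuous_at_imp_continuous_on ballI DERIV_isCont[OF *] DERIV_isCont[OF **])+
qed

text \<open>\<open>entire_solution\<close> demands joint continuity of the derivatives, but of
  \<open>u\<close> itself only separate regularity. A partial derivative in t together with a
  jointly continuous one in x makes \<open>u\<close> totally differentiable, hence jointly
  continuous.\<close>

lemma continuous_on_UNIV_partial_real:
  fixes u :: "real \<Rightarrow> real \<Rightarrow> real"
  assumes t: "\<And>t x. ((\<lambda>s. u s x) has_real_derivative ut t x) (at t)"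
    and x: "\<And>t x. (u t has_real_derivative ux t x) (at x)"
    and cont: "continuous_on UNIV (\<lambda>(t, x). ux t x)"
  shows "continuous_on UNIV (\<lambda>(t, x). u t x)"
proof (rule continuous_at_imp_continuous_on, clarify)
  fix t x :: real
  have c: "continuous_on UNIV (\<lambda>(t, x). blinfun_scaleR_left (ux t x))"
  proof -
    have "continuous_on UNIV (\<lambda>p. blinfun_scaleR_left (case p of (t, x) \<Rightarrow> ux t x))"
      using cont by (intro continuous_intros)
    then show ?thesis by (simp add: case_prod_unfold)
  qed
  have "((\<lambda>(t, x). u t x) has_derivative
      (\<lambda>(tt, tx). ut t x * tt + blinfun_scaleR_left (ux t x) tx)) (at (t, x) within UNIV \<times> UNIV)"
  proof (rule has_derivative_partialsI)
    show "((\<lambda>s. u s x) has_derivative (*) (ut t x)) (at t)"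
      using t has_field_derivative_def by blast
    show "(u s has_derivative blinfun_apply (blinfun_scaleR_left (ux s y))) (at y)" for s y
      using x[of s y] by (simp add: has_field_derivative_def mult_commute_abs)
    show "continuous (at (t, x) within UNIV \<times> UNIV)
        (\<lambda>(t, x). blinfun_scaleR_left (ux t x))"
      using c by (simp add: continuous_on_eq_continuous_at)
  qed auto
  then show "isCont (\<lambda>(t, x). u t x) (t, x)"
    by (metis has_derivative_continuous UNIV_Times_UNIV)
qed

lemma entire_solution_classical:
  assumes u: "entire_solution a f u" and a: "C2_real a"
  shows "classical_sol a f u"
proof -
  have t: "((\<lambda>s. u s x) has_real_derivative deriv (\<lambda>s. u s x) t) (at t)" for t x
    using u C1_differentiable_on_UNIV_real unfolding entire_solution_def by blast
  have C2: "C2_real (u t)" for t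
    using u unfolding entire_solution_def by blast
  note x = C2_realD(1)[OF C2] and xx = C2_realD(2)[OF C2]
  have "deriv (\<lambda>y. a y * deriv (u t) y) x = a x * deriv (deriv (u t)) x + deriv a x * deriv (u t) x"
    for t x
    by (rule DERIV_imp_deriv) (auto intro!: derivative_eq_intros C2_realD[OF a] xx)
  then have eq: "deriv (\<lambda>s. u s x) t = a x * deriv (deriv (u t)) x + deriv a x * deriv (u t) x + f x (u t x)"
    for t x
    using u unfolding entire_solution_def by simp
  have "continuous_on UNIV (\<lambda>(t, x). u t x)"
    using u unfolding entire_solution_def
    by (intro continuous_on_UNIV_partial_real[OF t x]) auto
  then show ?thesis
    unfolding classical_sol_def using t x xx eq
    by (intro conjI exI[of _ "\<lambda>t x. deriv (\<lambda>s. u s x) t"] exI[of _ "\<lambda>t. deriv (u t)"]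
        exI[of _ "\<lambda>t. deriv (deriv (u t))"]) auto
qed

lemma classical_sol_shift:
  assumes "classical_sol a f u"
  shows "classical_sol a f (\<lambda>t. u (t + s))"
proof -
  obtain ut ux uxx where D: "\<And>t x. ((\<lambda>s. u s x) has_real_derivative ut t x) (at t)"
    "\<And>t x. (u t has_real_derivative ux t x) (at x)"
    "\<And>t x. (ux t has_real_derivative uxx t x) (at x)"
    "\<And>t x. ut t x = a x * uxx t x + deriv a x * ux t x + f x (u t x)"
    and c: "continuous_on UNIV (\<lambda>(t, x). u t x)"
    using assms unfolding classical_sol_def by blast
  have "continuous_on UNIV (\<lambda>p. (\<lambda>(t, x). u t x) (fst p + s, snd p))"
    by (rule continuous_on_compose2[OF c]) (auto intro!: continuous_intros)
  moreover have "((\<lambda>t. u (t + s) x) has_real_derivative ut (t + s) x) (at t)" for t x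
    using D(1)[where t="t+s" and x=x] by (subst (asm) DERIV_shift)
  ultimately show ?thesis
    unfolding classical_sol_def using D
    by (intro conjI exI[of _ "\<lambda>t. ut (t + s)"] exI[of _ "\<lambda>t. ux (t + s)"]
        exI[of _ "\<lambda>t. uxx (t + s)"]) (auto simp: case_prod_unfold)
qed

section \<open>Derivative conditions at a maximum\<close>

text \<open>Only times up to \<open>t0\<close> are compared, so that the touching time may be the
  last one under consideration; this costs the vanishing of the derivative and leaves a
  sign.\<close>

lemma deriv_nonneg_at_left_max:
  fixes F :: "real \<Rightarrow> real"
  assumes F: "(F has_real_derivative D) (at t0)" and "d > 0"
    and max: "\<And>t. t0 - d < t \<Longrightarrow> t \<le> t0 \<Longrightarrow> F t \<le> F t0"
  shows "D \<ge> 0"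
proof (rule ccontr)
  assume "\<not> D \<ge> 0"
  then obtain e where e: "e > 0" "\<And>h. h > 0 \<Longrightarrow> h < e \<Longrightarrow> F t0 < F (t0 - h)"
    using has_real_derivative_neg_dec_left[OF F] by auto
  have "F t0 < F (t0 - min d e / 2)"
    using e(1) \<open>d > 0\<close> by (intro e(2)) auto
  moreover have "F (t0 - min d e / 2) \<le> F t0"
    using e(1) \<open>d > 0\<close> by (intro max) (auto simp: min_def)
  ultimately show False by simp
qed

lemma second_deriv_nonpos_at_local_max:
  fixes F :: "real \<Rightarrow> real"
  assumes F: "\<And>x. (F has_real_derivative F' x) (at x)"
    and F': "(F' has_real_derivative D) (at x0)" and "d > 0"
    and max: "\<And>x. \<bar>x - x0\<bar> < d \<Longrightarrow> F x \<le> F x0"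
  shows "F' x0 = 0" "D \<le> 0"
proof -
  show 0: "F' x0 = 0"
    using DERIV_local_max[OF F \<open>d > 0\<close>, of x0] max by (simp add: abs_minus_commute)
  show "D \<le> 0"
  proof (rule ccontr)
    assume "\<not> D \<le> 0"
    then obtain e where e: "e > 0" "\<And>h. h > 0 \<Longrightarrow> h < e \<Longrightarrow> F' (x0 + h) > 0"
      using has_real_derivative_pos_inc_right[OF F'] 0 by auto
    define h where "h = min d e / 2"
    have h: "0 < h" "h < d" "h < e"
      using e(1) \<open>d > 0\<close> by (auto simp: h_def min_def)
    have "\<exists>z. x0 < z \<and> z < x0 + h \<and> F (x0 + h) - F x0 = (x0 + h - x0) * F' z"
      using h F by (intro MVT2) auto
    then obtain z where z: "x0 < z" "z < x0 + h" "F (x0 + h) - F x0 = h * F' z"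
      by auto
    have "F' z > 0"
      using e(2)[of "z - x0"] z h by auto
    moreover have "F (x0 + h) \<le> F x0"
      using max h by auto
    ultimately show False
      using z h by (metis diff_gt_0_iff_gt mult_pos_pos not_less)
  qed
qed

text \<open>At the maximum of V1 - V2 - P the time derivative is nonnegative, the x-derivative
  vanishes and the second x-derivative is nonpositive; subtracting the two equations gives the
  inequality for P. The value of the maximum is left free: it is positive when P is minus a bump,
  and zero when P is a multiple of the weighted eigenfunction.\<close>

lemma classical_sol_touching:
  assumes V1: "classical_sol a f V1" and V2: "classical_sol a f V2" and a: "a x0 \<ge> 0"
    and Pt: "((\<lambda>t. P t x0) has_real_derivative Pt) (at t0)"
    and Px: "\<And>x. (P t0 has_real_derivative Px x) (at x)"
    and Pxx: "(Px has_real_derivative Pxx) (at x0)" and "d > 0"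
    and maxt: "\<And>t. t0 - d < t \<Longrightarrow> t \<le> t0 \<Longrightarrow>
      V1 t x0 - V2 t x0 - P t x0 \<le> V1 t0 x0 - V2 t0 x0 - P t0 x0"
    and maxx: "\<And>x. \<bar>x - x0\<bar> < d \<Longrightarrow>
      V1 t0 x - V2 t0 x - P t0 x \<le> V1 t0 x0 - V2 t0 x0 - P t0 x0"
  shows "Pt \<le> a x0 * Pxx + deriv a x0 * Px x0 + f x0 (V1 t0 x0) - f x0 (V2 t0 x0)"
proof -
  obtain ut ux uxx where u: "\<And>t x. ((\<lambda>s. V1 s x) has_real_derivative ut t x) (at t)"
    "\<And>t x. (V1 t has_real_derivative ux t x) (at x)"
    "\<And>t x. (ux t has_real_derivative uxx t x) (at x)"
    "\<And>t x. ut t x = a x * uxx t x + deriv a x * ux t x + f x (V1 t x)"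
    using V1 unfolding classical_sol_def by blast
  obtain vt vx vxx where v: "\<And>t x. ((\<lambda>s. V2 s x) has_real_derivative vt t x) (at t)"
    "\<And>t x. (V2 t has_real_derivative vx t x) (at x)"
    "\<And>t x. (vx t has_real_derivative vxx t x) (at x)"
    "\<And>t x. vt t x = a x * vxx t x + deriv a x * vx t x + f x (V2 t x)"
    using V2 unfolding classical_sol_def by blast
  have t: "ut t0 x0 - vt t0 x0 - Pt \<ge> 0"
    by (rule deriv_nonneg_at_left_max[where F = "\<lambda>t. V1 t x0 - V2 t x0 - P t x0", OF _ \<open>d > 0\<close>])
      (auto intro!: derivative_eq_intros u(1) v(1) Pt maxt)
  have d1: "((\<lambda>x. V1 t0 x - V2 t0 x - P t0 x) has_real_derivative ux t0 x - vx t0 x - Px x) (at x)" for x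
    by (auto intro!: derivative_eq_intros u v Px)
  have d2: "((\<lambda>x. ux t0 x - vx t0 x - Px x) has_real_derivative uxx t0 x0 - vxx t0 x0 - Pxx) (at x0)"
    by (auto intro!: derivative_eq_intros u v Pxx)
  note x = second_deriv_nonpos_at_local_max[OF d1 d2 \<open>d > 0\<close> maxx]
  have "a x0 * (uxx t0 x0 - vxx t0 x0 - Pxx) \<le> 0"
    using a x(2) by (simp add: mult_nonneg_nonpos)
  moreover have "deriv a x0 * (ux t0 x0 - vx t0 x0 - Px x0) = 0"
    using x(1) by simp
  ultimately show ?thesis
    using t u(4)[of t0 x0] v(4)[of t0 x0] by (simp add: algebra_simps)
qed

section \<open>Local bounds for the nonlinearity\<close>

lemma C1_plane_has_deriv:
  assumes "C1_plane f"
  shows "(f x has_real_derivative deriv (f x) u) (at u)"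
    and "continuous_on UNIV (\<lambda>(x, u). deriv (f x) u)"
proof -
  obtain D :: "real \<times> real \<Rightarrow> (real \<times> real) \<Rightarrow>\<^sub>L real"
    where D: "\<And>p. ((\<lambda>(x, u). f x u) has_derivative blinfun_apply (D p)) (at p)"
      "continuous_on UNIV D"
    using assms unfolding C1_plane_def by blast
  have der: "(f x has_real_derivative D (x, u) (0, 1)) (at u)" for x u
  proof -
    have "((\<lambda>v. (x, v)) has_derivative (\<lambda>h. (0, h))) (at u)"
      by (auto intro!: derivative_eq_intros)
    then have "((\<lambda>v. (\<lambda>(x, u). f x u) (x, v)) has_derivative (\<lambda>h. D (x, u) (0, h))) (at u)"
      using has_derivative_compose D(1) by blast
    moreover have "(\<lambda>h. D (x, u) (0, h)) = (*) (D (x, u) (0, 1))"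
    proof
      fix h :: real
      have "D (x, u) (0, h) = D (x, u) (h *\<^sub>R (0, 1))" by simp
      also have "\<dots> = D (x, u) (0, 1) * h" by (simp only: blinfun.scaleR_right) simp
      finally show "D (x, u) (0, h) = D (x, u) (0, 1) * h" .
    qed
    ultimately show ?thesis by (simp add: has_field_derivative_def)
  qed
  then have eq: "deriv (f x) u = D (x, u) (0, 1)" for x u
    using DERIV_imp_deriv by blast
  then show "(f x has_real_derivative deriv (f x) u) (at u)" using der by simp
  have "continuous_on UNIV (\<lambda>p. D p (0, 1))"
    by (intro continuous_intros D)
  then show "continuous_on UNIV (\<lambda>(x, u). deriv (f x) u)"
    by (simp add: eq case_prod_unfold)
qed

text \<open>Supplies the constant with which the decay rate of the bump absorbs the reaction
  term.\<close>

lemma C1_plane_Lipschitz: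
  assumes f: "C1_plane f"
  obtains H where "H \<ge> 0"
    "\<And>x u v. x \<in> {l..r} \<Longrightarrow> \<bar>u\<bar> \<le> R \<Longrightarrow> \<bar>v\<bar> \<le> R \<Longrightarrow> \<bar>f x u - f x v\<bar> \<le> H * \<bar>u - v\<bar>"
proof -
  have "compact ({l..r} \<times> {-R..R})"
    by (intro compact_Times) auto
  then have "compact ((\<lambda>(x, u). deriv (f x) u) ` ({l..r} \<times> {-R..R}))"
    using C1_plane_has_deriv(2)[OF f] by (meson compact_continuous_image continuous_on_subset subset_UNIV)
  then obtain H where H: "H > 0" "\<And>y. y \<in> (\<lambda>(x, u). deriv (f x) u) ` ({l..r} \<times> {-R..R}) \<Longrightarrow> norm y \<le> H"
    using compact_imp_bounded bounded_pos by metis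
  have "\<bar>f x u - f x v\<bar> \<le> H * \<bar>u - v\<bar>" if "x \<in> {l..r}" "\<bar>u\<bar> \<le> R" "\<bar>v\<bar> \<le> R" for x u v
  proof -
    have "norm (f x u - f x v) \<le> H * norm (u - v)"
    proof (rule field_differentiable_bound[where S = "{-R..R}" and f' = "deriv (f x)"])
      show "(f x has_field_derivative deriv (f x) z) (at z within {-R..R})" for z
        using C1_plane_has_deriv(1)[OF f] has_field_derivative_at_within by blast
      show "norm (deriv (f x) z) \<le> H" if "z \<in> {-R..R}" for z
        using H(2) that \<open>x \<in> {l..r}\<close> by fastforce
    qed (use that in auto)
    then show ?thesis by simp
  qed
  then show thesis using H(1) by (intro that[of H]) auto
qed

section \<open>Strong maximum principle\<close>

text \<open>Multiplied by the amplitude of the bump, this contradicts the touching inequality. Since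
  y^2 = r^2 - \<rho>, the diffusion term contributes -8 a0 r^2, which wins where \<rho> is small,
  and (K - H) \<rho>^2 wins where it is large; the terms linear in \<rho> are shared between the
  two.\<close>

lemma parabolic_bump_inequality:
  fixes a0 a1 \<alpha> A A1 \<beta> b H K r y :: real
  assumes "0 < \<alpha>" "\<alpha> \<le> a0" "a0 \<le> A" "\<bar>a1\<bar> \<le> A1" "\<bar>y\<bar> < r" "0 \<le> H"
    and K: "K = H + 1 + (4 * r * \<bar>\<beta>\<bar> + 12 * A + 4 * A1 * r)^2 / (32 * \<alpha> * r^2)"
  defines "\<rho> \<equiv> r^2 - y^2"
  shows "a0 * (4 * (\<rho> - 2 * y^2)) + a1 * (4 * \<rho> * y) + H * \<rho>^2 < K * \<rho>^2 - 4 * \<rho> * y * \<beta>"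
proof -
  define M where "M = 4 * r * \<bar>\<beta>\<bar> + 12 * A + 4 * A1 * r"
  have r: "r > 0" using assms by linarith
  have \<rho>: "\<rho> > 0"
    using \<open>\<bar>y\<bar> < r\<close> unfolding \<rho>_def
    by (metis abs_ge_zero diff_gt_0_iff_gt power2_abs power_strict_mono zero_less_numeral)
  have y: "y^2 = r^2 - \<rho>" by (simp add: \<rho>_def)
  have m: "y * \<beta> \<le> r * \<bar>\<beta>\<bar>"
    by (rule order_trans[OF abs_ge_self]) (use assms in \<open>auto simp: abs_mult intro!: mult_right_mono\<close>)
  have m2: "a1 * y \<le> A1 * r"
    by (rule order_trans[OF abs_ge_self]) (use assms in \<open>auto simp: abs_mult intro!: mult_mono\<close>)
  have "\<rho> * (4 * (y * \<beta>) + 12 * a0 + 4 * (a1 * y)) \<le> \<rho> * M"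
    using m m2 assms \<rho> unfolding M_def by (intro mult_left_mono) auto
  moreover have "8 * \<alpha> * r^2 \<le> 8 * a0 * r^2"
    using assms by (intro mult_right_mono) auto
  moreover have "\<rho> * M < (K - H) * \<rho>^2 + 8 * \<alpha> * r^2"
  proof -
    \<comment> \<open>Completing the square costs exactly s / 4 = 8 \<alpha> r^2, the amount that
      diffusion provides. The quotient M^2 / s is the last summand of \<open>K\<close>, and the
      summand 1 makes the inequality strict.\<close>
    define s where "s = 32 * \<alpha> * r^2"
    have s: "s > 0" using assms r by (simp add: s_def)
    have "0 \<le> (2 * M * \<rho> - s)^2 / (4 * s)" using s by simp
    also have "\<dots> = M^2 / s * \<rho>^2 - \<rho> * M + s / 4"
      using s by (simp add: field_simps power2_eq_square)
    finally have "\<rho> * M \<le> M^2 / s * \<rho>^2 + 8 * \<alpha> * r^2" by (simp add: s_def)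
    also have "\<dots> < (1 + M^2 / s) * \<rho>^2 + 8 * \<alpha> * r^2"
      using \<rho> by (simp add: distrib_right)
    finally show ?thesis using K by (simp add: M_def s_def)
  qed
  ultimately show ?thesis
    unfolding y by (simp add: algebra_simps)
qed

text \<open>
  Strong maximum principle: any two points \<open>(t1, x1)\<close>, \<open>(t2, x2)\<close> with \<open>t1 < t2\<close> are joined by a
  straight line, along which a decaying bump \<open>exp (- K t) (r\<^sup>2 - y\<^sup>2)\<^sup>2\<close> travels as a strict
  subsolution.
\<close>

lemma classical_sol_strict_propagates:
  assumes a: "C2_real a" "\<And>x. a x > 0" and f: "C1_plane f"
    and V1: "classical_sol a f V1" and V2: "classical_sol a f V2"
    and less: "V1 t1 x1 < V2 t1 x1" and "t1 < t2"
    and le: "\<And>t x. t1 \<le> t \<Longrightarrow> t \<le> t2 \<Longrightarrow> V1 t x \<le> V2 t x"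
  shows "V1 t2 x2 < V2 t2 x2"
proof -
  \<comment> \<open>Slope of the segment joining the two points; \<open>y\<close> is the signed
    distance in x to that segment and vanishes at both ends.\<close>
  define \<beta> where "\<beta> = (x2 - x1) / (t2 - t1)"
  define y where "y = (\<lambda>t x. x - x1 - \<beta> * (t - t1))"
  define z where "z = (\<lambda>t x. V2 t x - V1 t x)"
  have cV: "continuous_on UNIV (\<lambda>(t, x). V1 t x)" "continuous_on UNIV (\<lambda>(t, x). V2 t x)"
    using V1 V2 by (auto simp: classical_sol_def)
  have cz: "continuous_on UNIV (\<lambda>p. z (fst p) (snd p))"
    unfolding z_def by (intro continuous_intros continuous_on_classical_sol[OF V1]
        continuous_on_classical_sol[OF V2])
  have z1: "z t1 x1 > 0" using less by (simp add: z_def)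
  obtain r where r: "r > 0" "\<And>x. \<bar>x - x1\<bar> \<le> r \<Longrightarrow> z t1 x \<ge> z t1 x1 / 2"
  proof -
    have "continuous_on UNIV (z t1)"
      by (rule continuous_on_compose2[OF cz, of UNIV "\<lambda>x. (t1, x)", simplified])
        (auto intro!: continuous_intros)
    then have "isCont (z t1) x1" by (simp add: continuous_on_eq_continuous_at)
    then obtain d where "d > 0" "\<And>x. \<bar>x - x1\<bar> < d \<Longrightarrow> \<bar>z t1 x - z t1 x1\<bar> < z t1 x1 / 2"
      using z1 unfolding continuous_at_eps_delta dist_real_def by (metis half_gt_zero)
    note d = this
    show thesis
    proof (rule that[of "d/2"])
      fix x assume "\<bar>x - x1\<bar> \<le> d / 2"
      then have "\<bar>z t1 x - z t1 x1\<bar> < z t1 x1 / 2" using d by auto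
      then show "z t1 x \<ge> z t1 x1 / 2" by (simp add: abs_if split: if_splits)
    qed (use d in auto)
  qed
  \<comment> \<open>The interval {l..u} contains every x-section of the tube |y| <= r, so all bounds
    on coefficients and solutions are taken over it.\<close>
  define l where "l = x1 - \<bar>\<beta>\<bar> * (t2 - t1) - r"
  define u where "u = x1 + \<bar>\<beta>\<bar> * (t2 - t1) + r"
  have range: "x \<in> {l..u}" if "t1 \<le> t" "t \<le> t2" "\<bar>y t x\<bar> \<le> r" for t x
  proof -
    have "\<bar>\<beta> * (t - t1)\<bar> \<le> \<bar>\<beta>\<bar> * (t2 - t1)"
      using that by (auto simp: abs_mult intro: mult_left_mono)
    then show ?thesis using that by (auto simp: l_def u_def y_def)
  qed
  have ne: "{l..u} \<noteq> {}" using range[of t1 x1] \<open>t1 < t2\<close> r by (auto simp: y_def)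
  obtain \<alpha> where \<alpha>: "\<alpha> > 0" "\<And>x. x \<in> {l..u} \<Longrightarrow> \<alpha> \<le> a x"
    using continuous_attains_inf[OF _ ne continuous_on_subset[OF C2_realD(3)[OF a(1)]]] a(2)
    by (metis compact_Icc subset_UNIV)
  obtain A where A: "\<And>x. x \<in> {l..u} \<Longrightarrow> a x \<le> A"
    using continuous_attains_sup[OF _ ne continuous_on_subset[OF C2_realD(3)[OF a(1)]]]
    by (metis compact_Icc subset_UNIV)
  have "continuous_on UNIV (\<lambda>x. \<bar>deriv a x\<bar>)"
    using C2_realD(4)[OF a(1)] by (intro continuous_intros)
  then obtain A1 where A1: "\<And>x. x \<in> {l..u} \<Longrightarrow> \<bar>deriv a x\<bar> \<le> A1"
    using continuous_attains_sup[OF _ ne continuous_on_subset] by (metis compact_Icc subset_UNIV)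
  have bdd: "\<exists>R. \<forall>t\<in>{t1..t2}. \<forall>x\<in>{l..u}. \<bar>V t x\<bar> \<le> R"
    if "continuous_on UNIV (\<lambda>(t, x). V t x)" for V :: "real \<Rightarrow> real \<Rightarrow> real"
  proof -
    have "compact ((\<lambda>(t, x). V t x) ` ({t1..t2} \<times> {l..u}))"
      using that by (intro compact_continuous_image compact_Times) (auto intro: continuous_on_subset)
    then obtain R where R: "\<forall>y\<in>(\<lambda>(t, x). V t x) ` ({t1..t2} \<times> {l..u}). norm y \<le> R"
      using compact_imp_bounded bounded_iff by metis
    show ?thesis
      by (rule exI[of _ R]) (use R in force)
  qed
  obtain R1 R2 where R: "\<And>t x. t \<in> {t1..t2} \<Longrightarrow> x \<in> {l..u} \<Longrightarrow> \<bar>V1 t x\<bar> \<le> R1"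
    "\<And>t x. t \<in> {t1..t2} \<Longrightarrow> x \<in> {l..u} \<Longrightarrow> \<bar>V2 t x\<bar> \<le> R2"
    using bdd[OF cV(1)] bdd[OF cV(2)] by blast
  obtain H where H: "H \<ge> 0" "\<And>x u' v. x \<in> {l..u} \<Longrightarrow> \<bar>u'\<bar> \<le> max R1 R2 \<Longrightarrow> \<bar>v\<bar> \<le> max R1 R2 \<Longrightarrow>
      \<bar>f x u' - f x v\<bar> \<le> H * \<bar>u' - v\<bar>"
    using C1_plane_Lipschitz[OF f] by metis
  define K where "K = H + 1 + (4 * r * \<bar>\<beta>\<bar> + 12 * A + 4 * A1 * r)^2 / (32 * \<alpha> * r^2)"
  \<comment> \<open>At time \<open>t1\<close> the bump is at most \<epsilon> r^4, which is half of
    \<open>z t1 x1\<close> and so lies below \<open>z\<close> by the choice of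
    \<open>r\<close>.\<close>
  define \<epsilon> where "\<epsilon> = z t1 x1 / (2 * r^4)"
  define E where "E = (\<lambda>t. \<epsilon> * exp (- K * (t - t1)))"
  define P where "P = (\<lambda>t x. - E t * (r^2 - (y t x)^2)^2)"
  have E: "E t > 0" for t using z1 r by (simp add: E_def \<epsilon>_def)
  have "z t x + P t x \<ge> 0" if "t1 \<le> t" "t \<le> t2" "\<bar>y t x\<bar> \<le> r" for t x
  proof (rule ccontr)
    assume neg: "\<not> z t x + P t x \<ge> 0"
    \<comment> \<open>In the variables (t, y) the slanted tube is a rectangle, so the minimum of
      \<open>z\<close> minus the bump over it is attained.\<close>
    define G where "G = (\<lambda>p. z (fst p) (x1 + \<beta> * (fst p - t1) + snd p)
      - E (fst p) * (r^2 - (snd p)^2)^2)"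
    have "continuous_on UNIV (\<lambda>p. z (fst p) (x1 + \<beta> * (fst p - t1) + snd p))"
      by (rule continuous_on_compose2[OF cz, of UNIV
          "\<lambda>p. (fst p, x1 + \<beta> * (fst p - t1) + snd p)", simplified])
        (auto intro!: continuous_intros)
    then have cG: "continuous_on UNIV G"
      unfolding G_def E_def by (intro continuous_intros)
    have "compact ({t1..t2} \<times> {-r..r})" by (intro compact_Times) auto
    moreover have "({t1..t2} \<times> {-r..r}) \<noteq> {}" using \<open>t1 < t2\<close> r by auto
    ultimately obtain p0 where p0: "p0 \<in> {t1..t2} \<times> {-r..r}"
      "\<And>p. p \<in> {t1..t2} \<times> {-r..r} \<Longrightarrow> G p0 \<le> G p"
      using continuous_attains_inf[OF _ _ continuous_on_subset[OF cG]] by (metis subset_UNIV)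
    obtain t0 y0 where p0_eq: "p0 = (t0, y0)" by fastforce
    define x0 where "x0 = x1 + \<beta> * (t0 - t1) + y0"
    have y0: "y t0 x0 = y0" by (simp add: y_def x0_def)
    have GzP: "G (t, y t x) = z t x + P t x" for t x
      by (simp add: G_def P_def y_def)
    have min: "z t0 x0 + P t0 x0 \<le> z t x + P t x" if "t1 \<le> t" "t \<le> t2" "\<bar>y t x\<bar> \<le> r" for t x
      using p0(2)[of "(t, y t x)"] that GzP[of t x] GzP[of t0 x0] by (simp add: p0_eq y0 abs_le_iff)
    have neg0: "z t0 x0 + P t0 x0 < 0" using min[OF that] neg by linarith
    have t0: "t1 \<le> t0" "t0 \<le> t2" "\<bar>y0\<bar> \<le> r" using p0(1) by (auto simp: p0_eq)
    have z0: "z t0 x0 \<ge> 0" using le[of t0 x0] t0 by (simp add: z_def)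
    \<comment> \<open>A negative minimum avoids the lateral boundary, where the bump vanishes and z
      >= 0, and the initial time, where \<epsilon> is small enough.\<close>
    have "\<bar>y0\<bar> \<noteq> r"
    proof
      assume "\<bar>y0\<bar> = r"
      then have "y0^2 = r^2" by (metis power2_abs)
      then show False using neg0 z0 by (simp add: P_def y0)
    qed
    then have yr: "\<bar>y0\<bar> < r" using t0 by simp
    have "t0 \<noteq> t1"
    proof
      assume "t0 = t1"
      then have *: "\<bar>x0 - x1\<bar> \<le> r" using yr by (simp add: x0_def)
      have "(r^2 - y0^2)^2 \<le> (r^2)^2"
        using yr by (intro power_mono) (auto simp: abs_le_square_iff[symmetric])
      then have "z t1 x1 / (2 * r^4) * (r^2 - y0^2)^2 \<le> z t1 x1 / (2 * r^4) * r^4"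
        using z1 r by (intro mult_left_mono) (auto simp: power_mult[symmetric])
      then have "- P t0 x0 \<le> z t1 x1 / 2"
        using r y0 by (simp add: P_def E_def \<epsilon>_def \<open>t0 = t1\<close>)
      then show False using r(2)[OF *] neg0 \<open>t0 = t1\<close> by simp
    qed
    then have t10: "t1 < t0" using t0 by simp
    \<comment> \<open>The tube drifts with speed \<beta>; dividing by 1 + |\<beta>| keeps both the
      earlier points (t, x0) and the nearby points (t0, x) inside it.\<close>
    define d where "d = min (t0 - t1) ((r - \<bar>y0\<bar>) / (1 + \<bar>\<beta>\<bar>))"
    have d: "d > 0" "d \<le> t0 - t1" using t10 yr by (auto simp: d_def)
    have "d \<le> (r - \<bar>y0\<bar>) / (1 + \<bar>\<beta>\<bar>)" by (simp add: d_def)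
    moreover have "0 < 1 + \<bar>\<beta>\<bar>" by simp
    ultimately have "d * (1 + \<bar>\<beta>\<bar>) \<le> r - \<bar>y0\<bar>" by (simp only: pos_le_divide_eq)
    then have d2: "d + d * \<bar>\<beta>\<bar> \<le> r - \<bar>y0\<bar>" by (simp add: distrib_left)
    define \<rho> where "\<rho> = r^2 - y0^2"
    have "K * E t0 * \<rho>^2 - 4 * E t0 * \<rho> * y0 * \<beta>
        \<le> a x0 * (4 * E t0 * (\<rho> - 2 * y0^2)) + deriv a x0 * (4 * E t0 * \<rho> * y0)
          + f x0 (V1 t0 x0) - f x0 (V2 t0 x0)"
    proof -
      define Px where "Px = (\<lambda>x. 4 * E t0 * (r^2 - (y t0 x)^2) * y t0 x)"
      have Pxx0: "Px x0 = 4 * E t0 * \<rho> * y0"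
        by (simp add: Px_def y0 \<rho>_def)
      have "K * E t0 * \<rho>^2 - 4 * E t0 * \<rho> * y0 * \<beta>
          \<le> a x0 * (4 * E t0 * (\<rho> - 2 * y0^2)) + deriv a x0 * Px x0
            + f x0 (V1 t0 x0) - f x0 (V2 t0 x0)"
      proof (rule classical_sol_touching[OF V1 V2, where P = P and d = d])
        have Ed: "(E has_real_derivative - K * E t) (at t)" for t
          unfolding E_def by (auto intro!: derivative_eq_intros)
        have yt: "((\<lambda>t. y t x) has_real_derivative - \<beta>) (at t)" for t x
          unfolding y_def by (auto intro!: derivative_eq_intros)
        have yx: "(y t has_real_derivative 1) (at x)" for t x
          unfolding y_def by (auto intro!: derivative_eq_intros)
        show "((\<lambda>t. P t x0) has_real_derivative K * E t0 * \<rho>^2 - 4 * E t0 * \<rho> * y0 * \<beta>) (at t0)"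
          unfolding P_def
          by (rule derivative_eq_intros Ed yt refl)+
            (simp add: y0 \<rho>_def algebra_simps power2_eq_square)
        show "(P t0 has_real_derivative Px x) (at x)" for x
          unfolding P_def Px_def
          by (rule derivative_eq_intros yx refl)+ (simp add: algebra_simps power2_eq_square)
        show "(Px has_real_derivative 4 * E t0 * (\<rho> - 2 * y0^2)) (at x0)"
          unfolding Px_def
          by (rule derivative_eq_intros yx refl)+
            (simp add: y0 \<rho>_def algebra_simps power2_eq_square)
        show "a x0 \<ge> 0" using a(2)[of x0] by simp
        show "d > 0" by (fact d(1))
        show "V1 t x0 - V2 t x0 - P t x0 \<le> V1 t0 x0 - V2 t0 x0 - P t0 x0"
          if "t0 - d < t" "t \<le> t0" for t
        proof -
          have "y t x0 = y0 + \<beta> * (t0 - t)" by (simp add: y_def x0_def algebra_simps)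
          moreover have "\<bar>\<beta> * (t0 - t)\<bar> \<le> d * \<bar>\<beta>\<bar>"
            using that by (auto simp: abs_mult mult.commute[of d] intro: mult_left_mono)
          ultimately have "\<bar>y t x0\<bar> \<le> r" using d2 d(1) by linarith
          then have "z t0 x0 + P t0 x0 \<le> z t x0 + P t x0"
            using that d t0 by (intro min) auto
          then show ?thesis by (simp add: z_def)
        qed
        show "V1 t0 x - V2 t0 x - P t0 x \<le> V1 t0 x0 - V2 t0 x0 - P t0 x0"
          if "\<bar>x - x0\<bar> < d" for x
        proof -
          have "y t0 x = y0 + (x - x0)" by (simp add: y_def x0_def)
          moreover have "0 \<le> d * \<bar>\<beta>\<bar>" using d by simp
          ultimately have "\<bar>y t0 x\<bar> \<le> r" using d2 that by linarith
          then have "z t0 x0 + P t0 x0 \<le> z t0 x + P t0 x"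
            using t0 by (intro min) auto
          then show ?thesis by (simp add: z_def)
        qed
      qed
      then show ?thesis by (simp add: Pxx0)
    qed
    \<comment> \<open>The negative minimum gives 0 <= z < E \<rho>^2, so the Lipschitz bound can be
      expressed through the bump.\<close>
    moreover have "f x0 (V1 t0 x0) - f x0 (V2 t0 x0) \<le> H * (E t0 * \<rho>^2)"
    proof -
      have x0: "x0 \<in> {l..u}" using range[OF t0(1,2), of x0] t0 by (simp add: y0)
      have "\<bar>f x0 (V1 t0 x0) - f x0 (V2 t0 x0)\<bar> \<le> H * \<bar>V1 t0 x0 - V2 t0 x0\<bar>"
        using R[of t0 x0] t0 x0 by (intro H) (auto simp: le_max_iff_disj)
      also have "\<bar>V1 t0 x0 - V2 t0 x0\<bar> = z t0 x0" using z0 by (simp add: z_def)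
      also have "H * z t0 x0 \<le> H * (E t0 * \<rho>^2)"
        using neg0 H(1) by (intro mult_left_mono) (auto simp: P_def y0 \<rho>_def)
      finally show ?thesis by simp
    qed
    moreover have "E t0 * (a x0 * (4 * (\<rho> - 2 * y0^2)) + deriv a x0 * (4 * \<rho> * y0) + H * \<rho>^2)
        < E t0 * (K * \<rho>^2 - 4 * \<rho> * y0 * \<beta>)"
    proof (rule mult_strict_left_mono[OF _ E], unfold \<rho>_def, rule parabolic_bump_inequality)
      show "K = H + 1 + (4 * r * \<bar>\<beta>\<bar> + 12 * A + 4 * A1 * r)^2 / (32 * \<alpha> * r^2)"
        by (fact K_def)
    qed (use range[OF t0(1,2), of x0] t0 \<alpha> A A1 yr H(1) in \<open>auto simp: y0\<close>)
    ultimately show False by (simp add: algebra_simps)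
  qed
  moreover have "y t2 x2 = 0" using \<open>t1 < t2\<close> by (simp add: y_def \<beta>_def)
  ultimately have "z t2 x2 + P t2 x2 \<ge> 0" using \<open>t1 < t2\<close> r by auto
  moreover have "P t2 x2 < 0"
    using E[of t2] r by (simp add: P_def \<open>y t2 x2 = 0\<close>)
  ultimately show ?thesis by (simp add: z_def)
qed

section \<open>Periodic functions and comparison behind a moving point\<close>

lemma periodic_shift_int:
  assumes "periodic_fun_simple h L"
  shows "h (x + of_int n * L) = h x"
proof -
  interpret periodic_fun_simple h L by fact
  show ?thesis by (rule plus_of_int)
qed

lemma periodic_attains_inf:
  fixes h :: "real \<Rightarrow> real"
  assumes "L > 0" "continuous_on UNIV h" "periodic_fun_simple h L"
  obtains x0 where "\<And>x. h x0 \<le> h x"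
proof -
  obtain x0 where x0: "\<And>x. x \<in> {0..L} \<Longrightarrow> h x0 \<le> h x"
    using continuous_attains_inf[of "{0..L}" h] \<open>L > 0\<close> continuous_on_subset[OF assms(2)]
    by (metis compact_Icc atLeastatMost_empty_iff less_imp_le subset_UNIV linorder_not_less)
  have "h x0 \<le> h x" for x
  proof -
    define n where "n = \<lfloor>x / L\<rfloor>"
    have "of_int n \<le> x / L" "x / L \<le> of_int n + 1" by (simp_all add: n_def)
    then have "x - of_int n * L \<in> {0..L}"
      using \<open>L > 0\<close> by (simp add: field_simps)
    then show ?thesis using x0[of "x - of_int n * L"] periodic_shift_int[OF assms(3), of x "- n"] by simp
  qed
  then show thesis by (rule that)
qed

lemma periodic_bounded:
  fixes h :: "real \<Rightarrow> real"
  assumes "L > 0" "continuous_on UNIV h" "periodic_fun_simple h L"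
  obtains M where "\<And>x. \<bar>h x\<bar> \<le> M"
proof -
  have "continuous_on UNIV (\<lambda>x. - \<bar>h x\<bar>)" using assms by (intro continuous_intros)
  moreover have "periodic_fun_simple (\<lambda>x. - \<bar>h x\<bar>) L"
    using assms(3) by (simp add: periodic_fun_simple_def)
  ultimately obtain x0 where "\<And>x. - \<bar>h x0\<bar> \<le> - \<bar>h x\<bar>"
    using periodic_attains_inf[OF assms(1)] by metis
  then show thesis by (intro that[of "\<bar>h x0\<bar>"]) auto
qed

lemma periodic_deriv:
  fixes h :: "real \<Rightarrow> real"
  assumes "periodic_fun_simple h L" "\<And>x. (h has_real_derivative deriv h x) (at x)"
  shows "periodic_fun_simple (deriv h) L"
proof
  fix x
  have "((\<lambda>x. h (x + L)) has_real_derivative deriv h (x + L)) (at x)"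
    using assms(2)[of "x + L"] by (subst (asm) DERIV_shift)
  moreover have "(\<lambda>x. h (x + L)) = h"
    using assms(1) by (auto simp: periodic_fun_simple_def)
  ultimately show "deriv h (x + L) = deriv h x"
    using DERIV_imp_deriv by fastforce
qed

text \<open>
  The weight \<open>2 - exp (l (x - c t - b))\<close> makes the eigenfunction a strict supersolution even when
  \<open>\<mu> = 0\<close>, so that no strong maximum principle is needed here. The assumption \<open>cpt\<close> says that, up to
  translations, the difference exceeds a given \<open>\<epsilon> > 0\<close> only in a compact set; hence its supremum is
  attained.
\<close>

lemma comparison_left_of_moving_point:
  assumes L: "L > 0"
    and a: "C2_real a" "\<And>x. a x > 0" "periodic_fun_simple a L"
    and V1: "classical_sol a f V1" and V2: "classical_sol a f V2"
    and \<phi>: "C2_real \<phi>" "periodic_fun_simple \<phi> L" "\<And>x. \<phi> x > 0"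
      "\<And>x. deriv (\<lambda>y. a y * deriv \<phi> y) x + g x * \<phi> x = \<mu> * \<phi> x"
    and \<mu>: "\<mu> \<le> 0"
    and A: "\<And>t t'. t \<in> A \<Longrightarrow> t' \<le> t \<Longrightarrow> t' \<in> A"
    and bdry: "\<And>t. t \<in> A \<Longrightarrow> V1 t (c * t + b) \<le> V2 t (c * t + b)"
    and lin: "\<And>t x. t \<in> A \<Longrightarrow> x \<le> c * t + b \<Longrightarrow> V2 t x < V1 t x \<Longrightarrow>
      f x (V1 t x) - f x (V2 t x) \<le> g x * (V1 t x - V2 t x)"
    and cpt: "\<And>\<epsilon>. \<epsilon> > 0 \<Longrightarrow> \<exists>K. compact K \<and> K \<subseteq> {(t, x). t \<in> A \<and> x \<le> c * t + b} \<and>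
      (\<forall>t x. t \<in> A \<longrightarrow> x \<le> c * t + b \<longrightarrow> \<epsilon> \<le> V1 t x - V2 t x \<longrightarrow>
        (\<exists>t' x' n. (t', x') \<in> K \<and> x' = x + of_int n * L \<and> x' - c * t' = x - c * t \<and>
          V1 t' x' - V2 t' x' = V1 t x - V2 t x))"
    and "t \<in> A" "x \<le> c * t + b"
  shows "V1 t x \<le> V2 t x"
proof (rule ccontr)
  assume "\<not> V1 t x \<le> V2 t x"
  define w where "w = (\<lambda>t x. V1 t x - V2 t x)"
  have wpos: "w t x > 0" using \<open>\<not> V1 t x \<le> V2 t x\<close> by (simp add: w_def)
  \<comment> \<open>In the final inequality the terms carrying the exponential collect to l e a
    \<phi> (\<kappa> + l). The choice l = M + 1 makes this positive.\<close>
  define \<kappa> where "\<kappa> = (\<lambda>x. 2 * deriv \<phi> x / \<phi> x + (deriv a x + c) / a x)"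
  have "continuous_on UNIV \<kappa>"
    unfolding \<kappa>_def using a(2) \<phi>(3)
    by (intro continuous_intros C2_realD[OF a(1)] C2_realD[OF \<phi>(1)]) (auto simp: less_imp_neq[symmetric])
  moreover have "periodic_fun_simple \<kappa> L"
    using a(3) \<phi>(2) periodic_deriv[OF a(3) C2_realD(1)[OF a(1)]]
      periodic_deriv[OF \<phi>(2) C2_realD(1)[OF \<phi>(1)]]
    by (simp add: periodic_fun_simple_def \<kappa>_def)
  ultimately obtain M where M: "\<And>x. \<bar>\<kappa> x\<bar> \<le> M" using periodic_bounded[OF L] by metis
  define l where "l = M + 1"
  have l: "l > 0" "\<kappa> x + l > 0" for x using M[of x] by (auto simp: l_def)
  obtain x\<phi> where x\<phi>: "\<And>x. \<phi> x\<phi> \<le> \<phi> x"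
    using periodic_attains_inf[OF L C2_realD(3)[OF \<phi>(1)] \<phi>(2)] by metis
  define e where "e = (\<lambda>t x. exp (l * (x - c * t - b)))"
  define \<psi> where "\<psi> = (\<lambda>t x. \<phi> x * (2 - e t x))"
  have e: "0 < e t x" "x \<le> c * t + b \<Longrightarrow> e t x \<le> 1" for t x
    using l(1) by (auto simp: e_def mult_le_0_iff)
  have \<psi>ge: "\<phi> x\<phi> \<le> \<psi> t x" if "x \<le> c * t + b" for t x
  proof -
    have "\<phi> x\<phi> * 1 \<le> \<phi> x * (2 - e t x)"
      using x\<phi>[of x] \<phi>(3)[of x] \<phi>(3)[of x\<phi>] e(2)[OF that] by (intro mult_mono) auto
    then show ?thesis by (simp add: \<psi>_def)
  qed
  then have \<psi>pos: "\<psi> t x > 0" if "x \<le> c * t + b" for t x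
    using that \<phi>(3)[of x\<phi>] by (meson less_le_trans)
  \<comment> \<open>Since \<psi> is at least the minimum of \<phi>, every point whose ratio w /
    \<psi> is no smaller than at the assumed violation has w >= m1 min \<phi>. This is the threshold
    at which \<open>cpt\<close> is applied.\<close>
  define m1 where "m1 = w t x / \<psi> t x"
  have m1: "m1 > 0" using wpos \<psi>pos[OF \<open>x \<le> c * t + b\<close>] by (simp add: m1_def)
  then have "m1 * \<phi> x\<phi> > 0" using \<phi>(3) by simp
  from cpt[OF this] obtain K where "compact K \<and> K \<subseteq> {(t, x). t \<in> A \<and> x \<le> c * t + b} \<and>
      (\<forall>t x. t \<in> A \<longrightarrow> x \<le> c * t + b \<longrightarrow> m1 * \<phi> x\<phi> \<le> w t x \<longrightarrow>
        (\<exists>t' x' n. (t', x') \<in> K \<and> x' = x + of_int n * L \<and> x' - c * t' = x - c * t \<and>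
          w t' x' = w t x))"
    unfolding w_def by (elim exE)
  then have K: "compact K" "K \<subseteq> {(t, x). t \<in> A \<and> x \<le> c * t + b}"
    and K': "\<And>t x. t \<in> A \<Longrightarrow> x \<le> c * t + b \<Longrightarrow> m1 * \<phi> x\<phi> \<le> w t x \<Longrightarrow>
        (\<exists>t' x' n. (t', x') \<in> K \<and> x' = x + of_int n * L \<and> x' - c * t' = x - c * t \<and>
          w t' x' = w t x)"
    by simp_all
  \<comment> \<open>\<psi> depends on (t, x) through the periodic \<phi> and the moving coordinate,
    so it is invariant under the translations in \<open>cpt\<close>. The supremum of w / \<psi> is
    therefore a maximum over \<open>K\<close>.\<close>
  have toK: "\<exists>p\<in>K. w t x / \<psi> t x = w (fst p) (snd p) / \<psi> (fst p) (snd p)"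
    if t: "t \<in> A" "x \<le> c * t + b" and ge: "m1 \<le> w t x / \<psi> t x" for t x
  proof -
    have "m1 * \<phi> x\<phi> \<le> m1 * \<psi> t x" using \<psi>ge[OF t(2)] m1 by simp
    also have "\<dots> \<le> w t x" using ge \<psi>pos[OF t(2)] by (simp add: field_simps)
    finally obtain t' x' and n :: int where *: "(t', x') \<in> K" "x' = x + of_int n * L"
      "x' - c * t' = x - c * t" "w t' x' = w t x"
      using K'[OF t] by blast
    have "\<phi> x' = \<phi> x"
      by (simp add: *(2) periodic_shift_int[OF \<phi>(2)])
    then have "\<psi> t' x' = \<psi> t x" using *(3) by (simp add: \<psi>_def e_def)
    then show ?thesis using * by (intro bexI[of _ "(t', x')"]) auto
  qed
  define F where "F = (\<lambda>p. w (fst p) (snd p) / \<psi> (fst p) (snd p))"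
  have "continuous_on K F"
    unfolding F_def
  proof (intro continuous_on_divide ballI)
    show "continuous_on K (\<lambda>p. w (fst p) (snd p))"
      unfolding w_def by (intro continuous_intros continuous_on_classical_sol[OF V1]
          continuous_on_classical_sol[OF V2])
    have "continuous_on K (\<lambda>p. \<phi> (snd p))"
      by (rule continuous_on_compose2[OF C2_realD(3)[OF \<phi>(1)]]) (auto intro!: continuous_intros)
    then show "continuous_on K (\<lambda>p. \<psi> (fst p) (snd p))"
      unfolding \<psi>_def e_def by (intro continuous_intros)
    show "\<psi> (fst p) (snd p) \<noteq> 0" if "p \<in> K" for p
      using \<psi>pos[of "snd p" "fst p"] K(2) that by force
  qed
  moreover have "K \<noteq> {}" using toK[OF \<open>t \<in> A\<close> \<open>x \<le> c * t + b\<close>] by (auto simp: m1_def)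
  ultimately obtain p0 where p0: "p0 \<in> K" "\<And>p. p \<in> K \<Longrightarrow> F p \<le> F p0"
    using continuous_attains_sup[OF K(1)] by metis
  obtain t0 x0 where p0_eq: "p0 = (t0, x0)" by fastforce
  have tx0: "t0 \<in> A" "x0 \<le> c * t0 + b" using p0(1) K(2) by (auto simp: p0_eq)
  define m where "m = F p0"
  have mm1: "m1 \<le> m"
    using toK[OF \<open>t \<in> A\<close> \<open>x \<le> c * t + b\<close>] p0(2) by (auto simp: m1_def F_def m_def)
  then have m: "m > 0" using m1 by simp
  have le: "w t x - m * \<psi> t x \<le> 0" if t: "t \<in> A" "x \<le> c * t + b" for t x
  proof -
    have "w t x / \<psi> t x \<le> m"
    proof (cases "m1 \<le> w t x / \<psi> t x")
      case True
      then show ?thesis using toK[OF t] p0(2) by (auto simp: F_def m_def)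
    qed (use mm1 in auto)
    then show ?thesis using \<psi>pos[OF t(2)] by (simp add: field_simps)
  qed
  have eq: "w t0 x0 = m * \<psi> t0 x0"
    using \<psi>pos[OF tx0(2)] by (simp add: m_def F_def p0_eq)
  then have w0: "w t0 x0 > 0" using m \<psi>pos[OF tx0(2)] by simp
  \<comment> \<open>The touching point is off the boundary, where w <= 0; \<open>d\<close> then
    keeps the neighbouring points, also at earlier times, to the left of the moving point.\<close>
  have "x0 \<noteq> c * t0 + b" using bdry[OF tx0(1)] w0 by (auto simp: w_def)
  then have x0: "x0 < c * t0 + b" using tx0 by simp
  define d where "d = (c * t0 + b - x0) / (1 + \<bar>c\<bar>)"
  have d: "d > 0" using x0 by (simp add: d_def)
  have "0 < 1 + \<bar>c\<bar>" by simp
  then have "d * (1 + \<bar>c\<bar>) = c * t0 + b - x0" by (simp add: d_def)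
  then have d2: "d + d * \<bar>c\<bar> = c * t0 + b - x0" by (simp add: distrib_left)
  define Px where "Px = (\<lambda>x. m * (deriv \<phi> x * (2 - e t0 x) - l * \<phi> x * e t0 x))"
  have "m * (\<phi> x0 * (l * c * e t0 x0))
    \<le> a x0 * (m * (deriv (deriv \<phi>) x0 * (2 - e t0 x0) - 2 * l * deriv \<phi> x0 * e t0 x0
        - l^2 * \<phi> x0 * e t0 x0)) + deriv a x0 * Px x0 + f x0 (V1 t0 x0) - f x0 (V2 t0 x0)"
  proof (rule classical_sol_touching[OF V1 V2, where P = "\<lambda>t x. m * \<psi> t x" and d = d])
    have et: "((\<lambda>t. e t x) has_real_derivative - l * c * e t x) (at t)" for t x
      unfolding e_def by (auto intro!: derivative_eq_intros)
    have ex: "(e t has_real_derivative l * e t x) (at x)" for t x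
      unfolding e_def by (auto intro!: derivative_eq_intros)
    note \<phi>' = C2_realD(1,2)[OF \<phi>(1)]
    show "((\<lambda>t. m * \<psi> t x0) has_real_derivative m * (\<phi> x0 * (l * c * e t0 x0))) (at t0)"
      unfolding \<psi>_def by (rule derivative_eq_intros et refl)+ simp
    show "((\<lambda>x. m * \<psi> t0 x) has_real_derivative Px x) (at x)" for x
      unfolding \<psi>_def Px_def
      by (rule derivative_eq_intros ex \<phi>' refl)+ (simp add: algebra_simps)
    show "(Px has_real_derivative m * (deriv (deriv \<phi>) x0 * (2 - e t0 x0)
        - 2 * l * deriv \<phi> x0 * e t0 x0 - l^2 * \<phi> x0 * e t0 x0)) (at x0)"
      unfolding Px_def
      by (rule derivative_eq_intros ex \<phi>' refl)+ (simp add: algebra_simps power2_eq_square)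
    show "a x0 \<ge> 0" using a(2)[of x0] by simp
    show "d > 0" by (fact d)
    show "V1 t x0 - V2 t x0 - m * \<psi> t x0 \<le> V1 t0 x0 - V2 t0 x0 - m * \<psi> t0 x0"
      if "t0 - d < t" "t \<le> t0" for t
    proof -
      have "\<bar>c * (t0 - t)\<bar> \<le> d * \<bar>c\<bar>"
        using that by (auto simp: abs_mult mult.commute[of d] intro: mult_left_mono)
      then have "c * t0 - c * t \<le> d * \<bar>c\<bar>" by (simp add: right_diff_distrib)
      then have "x0 \<le> c * t + b" using d2 d by linarith
      then show ?thesis
        using le[of t x0] A[OF tx0(1) that(2)] eq by (simp add: w_def)
    qed
    show "V1 t0 x - V2 t0 x - m * \<psi> t0 x \<le> V1 t0 x0 - V2 t0 x0 - m * \<psi> t0 x0"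
      if "\<bar>x - x0\<bar> < d" for x
    proof -
      have "0 \<le> d * \<bar>c\<bar>" using d by simp
      then have "x \<le> c * t0 + b" using d2 that by linarith
      then show ?thesis using le[of t0 x] tx0 eq by (simp add: w_def)
    qed
  qed
  also have "\<dots> \<le> a x0 * (m * (deriv (deriv \<phi>) x0 * (2 - e t0 x0) - 2 * l * deriv \<phi> x0 * e t0 x0
        - l^2 * \<phi> x0 * e t0 x0)) + deriv a x0 * Px x0 + g x0 * (m * \<psi> t0 x0)"
    using lin[OF tx0] w0 eq by (simp add: w_def)
  \<comment> \<open>The factor 2 - e multiplies the eigenvalue operator applied to \<phi>, that is
    \<mu> \<phi>; the x-derivatives of the weight give the group with l e, which the time derivative
    on the left side will join.\<close>
  also have "\<dots> = m * ((2 - e t0 x0) * (a x0 * deriv (deriv \<phi>) x0 + deriv a x0 * deriv \<phi> x0 + g x0 * \<phi> x0)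
      - l * e t0 x0 * (2 * a x0 * deriv \<phi> x0 + deriv a x0 * \<phi> x0 + a x0 * l * \<phi> x0))"
    by (simp add: Px_def \<psi>_def algebra_simps power2_eq_square)
  also have "a x0 * deriv (deriv \<phi>) x0 + deriv a x0 * deriv \<phi> x0 + g x0 * \<phi> x0 = \<mu> * \<phi> x0"
  proof -
    have "deriv (\<lambda>y. a y * deriv \<phi> y) x0 = a x0 * deriv (deriv \<phi>) x0 + deriv a x0 * deriv \<phi> x0"
      by (rule DERIV_imp_deriv)
        (auto intro!: derivative_eq_intros C2_realD(1)[OF a(1)] C2_realD(2)[OF \<phi>(1)])
    then show ?thesis using \<phi>(4)[of x0] by simp
  qed
  finally have "m * (l * e t0 x0 * (2 * a x0 * deriv \<phi> x0 + (deriv a x0 + c) * \<phi> x0 + a x0 * l * \<phi> x0))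
      \<le> m * ((2 - e t0 x0) * (\<mu> * \<phi> x0))"
    by (simp add: algebra_simps)
  moreover have "m * ((2 - e t0 x0) * (\<mu> * \<phi> x0)) \<le> 0"
    using m \<mu> \<phi>(3)[of x0] e(2)[OF tx0(2)]
    by (intro mult_nonneg_nonpos mult_nonpos_nonneg) auto
  moreover have "2 * a x0 * deriv \<phi> x0 + (deriv a x0 + c) * \<phi> x0 + a x0 * l * \<phi> x0
      = a x0 * \<phi> x0 * (\<kappa> x0 + l)"
    using a(2)[of x0] \<phi>(3)[of x0] by (simp add: \<kappa>_def field_simps)
  moreover have "0 < m * (l * e t0 x0 * (a x0 * \<phi> x0 * (\<kappa> x0 + l)))"
    using m l e a(2) \<phi>(3) by simp
  ultimately show False by simp
qed

section \<open>Traveling waves and steepness\<close>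

text \<open>Eliminates the profile: the limits become uniform in the moving coordinate, and
  periodicity becomes invariance under a shift by periods that keeps this coordinate.\<close>

lemma traveling_waveD:
  assumes "traveling_wave a f L r q c u"
  shows "entire_solution a f u"
    and "e > 0 \<Longrightarrow> \<exists>N. \<forall>t x. x - c * t \<ge> N \<longrightarrow> \<bar>u t x - r x\<bar> < e"
    and "e > 0 \<Longrightarrow> \<exists>N. \<forall>t x. x - c * t \<le> N \<longrightarrow> \<bar>u t x - q x\<bar> < e"
    and "x + of_int n * L - c * t' = x - c * t \<Longrightarrow> u t' (x + of_int n * L) = u t x"
proof -
  obtain U where u: "\<And>t x. u t x = U (x - c * t) x"
    and per: "\<And>z. periodic_fun_simple (U z) L"
    and lim: "uniform_limit UNIV U r at_top" "uniform_limit UNIV U q at_bot"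
    using assms unfolding traveling_wave_def by blast
  show "entire_solution a f u" using assms unfolding traveling_wave_def by blast
  show "\<exists>N. \<forall>t x. x - c * t \<ge> N \<longrightarrow> \<bar>u t x - r x\<bar> < e" if "e > 0"
    using uniform_limitD[OF lim(1) that] unfolding eventually_at_top_linorder dist_real_def u by blast
  show "\<exists>N. \<forall>t x. x - c * t \<le> N \<longrightarrow> \<bar>u t x - q x\<bar> < e" if "e > 0"
    using uniform_limitD[OF lim(2) that] unfolding eventually_at_bot_linorder dist_real_def u by blast
  show "u t' (x + of_int n * L) = u t x" if "x + of_int n * L - c * t' = x - c * t"
    by (simp only: u that periodic_shift_int[OF per])
qed

text \<open>On the left, the mean value theorem picks a value between \<open>u\<^sub>2\<close>, at
  least q - \<delta>, and \<open>u\<^sub>1\<close>, at most q, where the bound by \<open>g\<close>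
  holds. On the right, a wrong order would force a crossing in between, after which steepness
  restores the order. Steepness allows two different times, so it covers the shift
  \<open>s\<close>.\<close>

lemma steeper_comparison:
  assumes L: "L > 0"
    and a: "C2_real a" "\<And>x. a x > 0" "periodic_fun_simple a L"
    and f: "C1_plane f"
    and u1: "classical_sol a f u\<^sub>1" and u2: "classical_sol a f u\<^sub>2"
    and steep: "steeper u\<^sub>1 u\<^sub>2"
    and eig: "principal_eigenvalue a L g \<mu>" "\<mu> \<le> 0"
    and g: "\<And>x u. q x - \<delta> \<le> u \<Longrightarrow> u \<le> q x \<Longrightarrow> deriv (f x) u \<le> g x"
    and u1_le: "\<And>t x. u\<^sub>1 t x \<le> q x"
    and u2_ge: "\<And>t x. x \<le> c * t + b \<Longrightarrow> q x - \<delta> \<le> u\<^sub>2 t x"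
    and A: "\<And>t t'. t \<in> A \<Longrightarrow> t' \<le> t \<Longrightarrow> t' \<in> A"
    and bdry: "\<And>t. t \<in> A \<Longrightarrow> u\<^sub>1 (t + s) (c * t + b) < u\<^sub>2 t (c * t + b)"
    and cpt: "\<And>\<epsilon>. \<epsilon> > 0 \<Longrightarrow> \<exists>K. compact K \<and> K \<subseteq> {(t, x). t \<in> A \<and> x \<le> c * t + b} \<and>
      (\<forall>t x. t \<in> A \<longrightarrow> x \<le> c * t + b \<longrightarrow> \<epsilon> \<le> u\<^sub>1 (t + s) x - u\<^sub>2 t x \<longrightarrow>
        (\<exists>t' x' n. (t', x') \<in> K \<and> x' = x + of_int n * L \<and> x' - c * t' = x - c * t \<and>
          u\<^sub>1 (t' + s) x' - u\<^sub>2 t' x' = u\<^sub>1 (t + s) x - u\<^sub>2 t x))"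
    and t: "t \<in> A"
  shows "u\<^sub>1 (t + s) x \<le> u\<^sub>2 t x"
proof (cases "x \<le> c * t + b")
  case True
  obtain \<phi> where \<phi>: "C2_real \<phi>" "periodic_fun_simple \<phi> L" "\<And>x. \<phi> x > 0"
    "\<And>x. deriv (\<lambda>y. a y * deriv \<phi> y) x + g x * \<phi> x = \<mu> * \<phi> x"
    using eig(1) unfolding principal_eigenvalue_def by blast
  have lin: "f x (u\<^sub>1 (t + s) x) - f x (u\<^sub>2 t x) \<le> g x * (u\<^sub>1 (t + s) x - u\<^sub>2 t x)"
    if "x \<le> c * t + b" "u\<^sub>2 t x < u\<^sub>1 (t + s) x" for t x
  proof -
    have "\<exists>v. u\<^sub>2 t x < v \<and> v < u\<^sub>1 (t + s) x \<and> f x (u\<^sub>1 (t + s) x) - f x (u\<^sub>2 t x)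
        = (u\<^sub>1 (t + s) x - u\<^sub>2 t x) * deriv (f x) v"
      using that(2) by (intro MVT2 C1_plane_has_deriv(1)[OF f])
    then obtain v where v: "u\<^sub>2 t x < v" "v < u\<^sub>1 (t + s) x"
      "f x (u\<^sub>1 (t + s) x) - f x (u\<^sub>2 t x) = (u\<^sub>1 (t + s) x - u\<^sub>2 t x) * deriv (f x) v"
      by blast
    have "deriv (f x) v \<le> g x"
      using v(1,2) u2_ge[OF that(1)] u1_le[of "t + s" x] by (intro g) auto
    then show ?thesis
      unfolding v(3) mult.commute[of "g x"] using that(2) by (intro mult_left_mono) auto
  qed
  show ?thesis
  proof (rule comparison_left_of_moving_point[OF L a classical_sol_shift[OF u1] u2 \<phi> eig(2),
        where A = A and c = c and b = b])
    show "f x (u\<^sub>1 (t + s) x) - f x (u\<^sub>2 t x) \<le> g x * (u\<^sub>1 (t + s) x - u\<^sub>2 t x)"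
      if "x \<le> c * t + b" "u\<^sub>2 t x < u\<^sub>1 (t + s) x" for t x
      using that by (rule lin)
  qed (fact A less_imp_le[OF bdry] cpt t True)+
next
  case False
  show ?thesis
  proof (rule ccontr)
    assume neg: "\<not> u\<^sub>1 (t + s) x \<le> u\<^sub>2 t x"
    have "continuous_on {c * t + b..x} (\<lambda>x. u\<^sub>1 (t + s) x - u\<^sub>2 t x)"
      by (intro continuous_intros continuous_on_classical_sol[OF u1] continuous_on_classical_sol[OF u2])
    then have "\<exists>y\<ge>c * t + b. y \<le> x \<and> u\<^sub>1 (t + s) y - u\<^sub>2 t y = 0"
      using bdry[OF t] neg False by (intro IVT') auto
    then obtain y where "y \<le> x" "u\<^sub>1 (t + s) y = u\<^sub>2 t y" by auto
    then have "u\<^sub>1 (t + s) x \<le> u\<^sub>2 t x" using steep unfolding steeper_def by blast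
    then show False using neg by simp
  qed
qed

text \<open>Brings any time into one compact period by multiples of L / c, the time component of the
  translation that preserves x - c t.\<close>

lemma shift_into_period:
  fixes L c t :: real
  assumes "L > 0" "c \<noteq> 0"
  obtains n :: int where "t + of_int n * L / c \<in> {0..L / \<bar>c\<bar>}"
proof -
  define p where "p = L / \<bar>c\<bar>"
  have p: "p > 0" using assms by (simp add: p_def)
  define k where "k = \<lfloor>t / p\<rfloor>"
  have "of_int k \<le> t / p" "t / p \<le> of_int k + 1" by (simp_all add: k_def)
  then have "t - of_int k * p \<in> {0..p}" using p by (simp add: field_simps)
  moreover have "of_int (if c > 0 then - k else k) * L / c = - (of_int k * p)"
    using assms by (auto simp: p_def)
  ultimately show thesis by (intro that[of "if c > 0 then - k else k"]) (simp add: p_def)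
qed

section \<open>Order of the speeds and uniqueness up to a time shift\<close>

theorem theorem4p1:
  fixes L :: real and a :: "real \<Rightarrow> real" and f :: "real \<Rightarrow> real \<Rightarrow> real"
    and q\<^sub>1 q\<^sub>2 q :: "real \<Rightarrow> real"
    and U\<^sub>1 U\<^sub>2 :: "real \<Rightarrow> real \<Rightarrow> real" and c\<^sub>1 c\<^sub>2 :: real
  assumes L: "L > 0"
    and a: "C2_real a" "\<And>x. a x > 0" "periodic_fun_simple a L"
    and f: "C1_plane f" "\<And>x u. f (x + L) u = f x u" "\<And>x. f x 0 = 0"
    and q: "stationary_solution a f q" "periodic_fun_simple q L"
    and q\<^sub>1: "stationary_solution a f q\<^sub>1" "periodic_fun_simple q\<^sub>1 L" "\<And>x. q\<^sub>1 x < q x"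
    and q\<^sub>2: "stationary_solution a f q\<^sub>2" "periodic_fun_simple q\<^sub>2 L" "\<And>x. q\<^sub>2 x < q x"
    and U\<^sub>1: "traveling_wave a f L q\<^sub>1 q c\<^sub>1 U\<^sub>1"
    and U\<^sub>2: "traveling_wave a f L q\<^sub>2 q c\<^sub>2 U\<^sub>2"
    and U\<^sub>1_le: "\<And>t x. U\<^sub>1 t x \<le> q x"
    and g: "\<exists>\<delta>>0. \<exists>g. periodic_fun_simple g L \<and>
              (\<exists>\<mu>. principal_eigenvalue a L g \<mu> \<and> \<mu> \<le> 0) \<and>
              (\<forall>x. \<forall>u\<in>{q x - \<delta>..q x}. deriv (f x) u \<le> g x)"
    and steep: "steeper U\<^sub>1 U\<^sub>2"
  shows "c\<^sub>1 \<le> c\<^sub>2 \<and>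
    (c\<^sub>1 = c\<^sub>2 \<and> c\<^sub>1 \<noteq> 0 \<longrightarrow> (\<exists>\<tau>. \<forall>t x. U\<^sub>1 t x = U\<^sub>2 (t + \<tau>) x))"
proof -
  obtain \<delta> g \<mu> where \<delta>: "\<delta> > 0" and eig: "principal_eigenvalue a L g \<mu>" "\<mu> \<le> 0"
    and g: "\<And>x u. q x - \<delta> \<le> u \<Longrightarrow> u \<le> q x \<Longrightarrow> deriv (f x) u \<le> g x"
    using g by fastforce
  have contq: "continuous_on UNIV v" if "stationary_solution a f v" for v
    using continuous_on_classical_sol[OF entire_solution_classical, of a f "\<lambda>t. v" UNIV "\<lambda>x. 0" "\<lambda>x. x"]
      that a(1) by (simp add: stationary_solution_def)
  have gap: "\<exists>m>0. \<forall>x. m \<le> q x - v x"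
    if v: "stationary_solution a f v" "periodic_fun_simple v L" "\<And>x. v x < q x" for v
  proof -
    have "continuous_on UNIV (\<lambda>x. q x - v x)"
      using contq[OF v(1)] contq[OF q(1)] by (intro continuous_intros)
    moreover have "periodic_fun_simple (\<lambda>x. q x - v x) L"
      using v(2) q(2) by (simp add: periodic_fun_simple_def)
    ultimately obtain x0 where "\<And>x. q x0 - v x0 \<le> q x - v x"
      using periodic_attains_inf[OF L, of "\<lambda>x. q x - v x"] by blast
    then show ?thesis using v(3)[of x0] by (intro exI[of _ "q x0 - v x0"]) auto
  qed
  obtain m1 m2 where m: "m1 > 0" "\<And>x. m1 \<le> q x - q\<^sub>1 x" "m2 > 0" "\<And>x. m2 \<le> q x - q\<^sub>2 x"
    using gap[OF q\<^sub>1] gap[OF q\<^sub>2] by auto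
  \<comment> \<open>The bound by \<delta> makes the estimate for \<open>g\<close> available left of
    the moving point; half the gaps separate the \<open>e\<close>-neighbourhoods of \<open>q\<close>
    from those of the right limits.\<close>
  define e where "e = min \<delta> (min (m1 / 2) (m2 / 2))"
  have e: "e > 0" "e \<le> \<delta>" using \<delta> m by (auto simp: e_def)
  have e1: "q\<^sub>1 x + e \<le> q x - e" for x using m(2)[of x] by (auto simp: e_def min_def)
  have e2: "q\<^sub>2 x + e \<le> q x - e" for x using m(4)[of x] by (auto simp: e_def min_def)
  note sol1 = entire_solution_classical[OF traveling_waveD(1)[OF U\<^sub>1] a(1)]
  note sol2 = entire_solution_classical[OF traveling_waveD(1)[OF U\<^sub>2] a(1)]
  obtain N1 where N1: "\<And>t x. x - c\<^sub>1 * t \<ge> N1 \<Longrightarrow> \<bar>U\<^sub>1 t x - q\<^sub>1 x\<bar> < e"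
    using traveling_waveD(2)[OF U\<^sub>1 e(1)] by blast
  obtain M1 where M1: "\<And>t x. x - c\<^sub>1 * t \<le> M1 \<Longrightarrow> \<bar>U\<^sub>1 t x - q x\<bar> < e"
    using traveling_waveD(3)[OF U\<^sub>1 e(1)] by blast
  obtain N2 where N2: "\<And>t x. x - c\<^sub>2 * t \<ge> N2 \<Longrightarrow> \<bar>U\<^sub>2 t x - q\<^sub>2 x\<bar> < e"
    using traveling_waveD(2)[OF U\<^sub>2 e(1)] by blast
  obtain b where b: "\<And>t x. x - c\<^sub>2 * t \<le> b \<Longrightarrow> \<bar>U\<^sub>2 t x - q x\<bar> < e"
    using traveling_waveD(3)[OF U\<^sub>2 e(1)] by blast
  have less: "U\<^sub>1 t' x < U\<^sub>2 t x" if "x - c\<^sub>1 * t' \<ge> N1" "x - c\<^sub>2 * t \<le> b" for t t' x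
    using N1[OF that(1)] b[OF that(2)] e1[of x] by linarith
  have greater: "U\<^sub>2 t x < U\<^sub>1 t' x" if "x - c\<^sub>1 * t' \<le> M1" "x - c\<^sub>2 * t \<ge> N2" for t t' x
    using M1[OF that(1)] N2[OF that(2)] e2[of x] by linarith
  have u2_ge: "q x - \<delta> \<le> U\<^sub>2 t x" if "x \<le> c\<^sub>2 * t + b" for t x
    using b[of x t] that e by simp
  note compare = steeper_comparison[OF L a f(1) sol1 sol2 steep eig g U\<^sub>1_le u2_ge]
  \<comment> \<open>As \<open>U\<^sub>1\<close> stays below \<open>q\<close>, an excess of
    \<epsilon> over \<open>U\<^sub>2\<close> keeps \<open>U\<^sub>2\<close> that far from its left
    limit. Hence the bound is uniform in the shift.\<close>
  have far_left: "\<exists>Z. \<forall>t x s. \<epsilon> \<le> U\<^sub>1 (t + s) x - U\<^sub>2 t x \<longrightarrow> Z < x - c\<^sub>2 * t" if "\<epsilon> > 0" for \<epsilon>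
  proof -
    obtain Z where Z: "\<And>t x. x - c\<^sub>2 * t \<le> Z \<Longrightarrow> \<bar>U\<^sub>2 t x - q x\<bar> < \<epsilon>"
      using traveling_waveD(3)[OF U\<^sub>2 \<open>\<epsilon> > 0\<close>] by blast
    have "Z < x - c\<^sub>2 * t" if "\<epsilon> \<le> U\<^sub>1 (t + s) x - U\<^sub>2 t x" for t x s
      using Z[of x t] U\<^sub>1_le[of "t + s" x] that by (cases "x - c\<^sub>2 * t \<le> Z") linarith+
    then show ?thesis by blast
  qed
  have strip: "compact ((\<lambda>(t, y). (t, y + c\<^sub>2 * t)) ` ({t1..t2} \<times> {y1..y2 :: real}))" for t1 t2 y1 y2
    by (intro compact_continuous_image compact_Times)
      (auto simp: case_prod_unfold intro!: continuous_intros)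
  have "c\<^sub>1 \<le> c\<^sub>2"
  proof (rule ccontr)
    assume "\<not> c\<^sub>1 \<le> c\<^sub>2"
    then have c: "c\<^sub>1 - c\<^sub>2 > 0" by simp
    define h where "h = (\<lambda>t. U\<^sub>1 t (c\<^sub>2 * t + b) - U\<^sub>2 t (c\<^sub>2 * t + b))"
    have ch: "continuous_on UNIV h"
      unfolding h_def
      by (intro continuous_intros continuous_on_classical_sol[OF sol1] continuous_on_classical_sol[OF sol2])
    have comp: "U\<^sub>1 t x \<le> U\<^sub>2 t x" if neg: "\<And>t'. t' \<le> t \<Longrightarrow> h t' < 0" for t x
    proof -
      have "U\<^sub>1 (t + 0) x \<le> U\<^sub>2 t x"
      proof (rule compare[where A = "{..t}" and b = b])
        fix \<epsilon> :: real assume "\<epsilon> > 0"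
        then obtain Z where Z: "\<And>t x s. \<epsilon> \<le> U\<^sub>1 (t + s) x - U\<^sub>2 t x \<Longrightarrow> Z < x - c\<^sub>2 * t"
          using far_left by blast
        \<comment> \<open>An excess requires \<open>x - c\<^sub>1 * t < N1\<close> by
          \<open>less\<close> and \<open>Z < x - c\<^sub>2 * t\<close>; subtracting bounds the time
          from below. The set is then compact without any translation, so n = 0.\<close>
        define t1 where "t1 = (Z - N1) / (c\<^sub>1 - c\<^sub>2)"
        define K where "K = (\<lambda>(t, y). (t, y + c\<^sub>2 * t)) ` ({t1..t} \<times> {Z..b})"
        have "(t', x') \<in> K"
          if tx: "t' \<le> t" "x' \<le> c\<^sub>2 * t' + b" "\<epsilon> \<le> U\<^sub>1 (t' + 0) x' - U\<^sub>2 t' x'" for t' x'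
        proof -
          have Zx: "Z < x' - c\<^sub>2 * t'" using Z tx(3) by blast
          have "x' - c\<^sub>1 * t' < N1"
            using less[where t = t' and t' = t' and x = x'] tx \<open>\<epsilon> > 0\<close> by (cases "x' - c\<^sub>1 * t' < N1") auto
          then have "Z - N1 \<le> t' * (c\<^sub>1 - c\<^sub>2)" using Zx by (simp add: algebra_simps)
          then have "t1 \<le> t'" using c by (simp add: t1_def pos_divide_le_eq)
          then show ?thesis
            unfolding K_def using tx Zx by (intro image_eqI[of _ _ "(t', x' - c\<^sub>2 * t')"]) auto
        qed
        then have "\<forall>t' x'. t' \<in> {..t} \<longrightarrow> x' \<le> c\<^sub>2 * t' + b \<longrightarrow> \<epsilon> \<le> U\<^sub>1 (t' + 0) x' - U\<^sub>2 t' x' \<longrightarrow>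
          (\<exists>t'' x'' n. (t'', x'') \<in> K \<and> x'' = x' + of_int n * L \<and> x'' - c\<^sub>2 * t'' = x' - c\<^sub>2 * t' \<and>
            U\<^sub>1 (t'' + 0) x'' - U\<^sub>2 t'' x'' = U\<^sub>1 (t' + 0) x' - U\<^sub>2 t' x')"
          by (metis add.right_neutral atMost_iff mult_zero_left of_int_0)
        moreover have "compact K" unfolding K_def by (rule strip)
        moreover have "K \<subseteq> {(t', x). t' \<in> {..t} \<and> x \<le> c\<^sub>2 * t' + b}" by (auto simp: K_def)
        ultimately show "\<exists>K. compact K \<and> K \<subseteq> {(t', x). t' \<in> {..t} \<and> x \<le> c\<^sub>2 * t' + b} \<and>
          (\<forall>t' x'. t' \<in> {..t} \<longrightarrow> x' \<le> c\<^sub>2 * t' + b \<longrightarrow> \<epsilon> \<le> U\<^sub>1 (t' + 0) x' - U\<^sub>2 t' x' \<longrightarrow>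
          (\<exists>t'' x'' n. (t'', x'') \<in> K \<and> x'' = x' + of_int n * L \<and> x'' - c\<^sub>2 * t'' = x' - c\<^sub>2 * t' \<and>
            U\<^sub>1 (t'' + 0) x'' - U\<^sub>2 t'' x'' = U\<^sub>1 (t' + 0) x' - U\<^sub>2 t' x'))"
          by blast
      qed (use neg in \<open>auto simp: h_def\<close>)
      then show ?thesis by simp
    qed
    define B where "B = {t. h t \<ge> 0}"
    have "B \<noteq> {}"
    proof
      assume "B = {}"
      then have neg: "h t < 0" for t by (auto simp: B_def not_le)
      \<comment> \<open>At this time the point \<open>c\<^sub>2 * t + N2\<close> has moving
        coordinate \<open>M1\<close> for the first wave and \<open>N2\<close> for the second, so the
        faster wave has overtaken there.\<close>
      define t where "t = (N2 - M1) / (c\<^sub>1 - c\<^sub>2)"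
      have "t * (c\<^sub>1 - c\<^sub>2) = N2 - M1" using c by (simp add: t_def)
      then have "U\<^sub>2 t (c\<^sub>2 * t + N2) < U\<^sub>1 t (c\<^sub>2 * t + N2)"
        by (intro greater) (auto simp: algebra_simps)
      moreover have "U\<^sub>1 t (c\<^sub>2 * t + N2) \<le> U\<^sub>2 t (c\<^sub>2 * t + N2)"
        by (rule comp) (rule neg)
      ultimately show False by simp
    qed
    have "t > (b - N1) / (c\<^sub>1 - c\<^sub>2)" if "t \<in> B" for t
    proof (rule ccontr)
      assume "\<not> t > (b - N1) / (c\<^sub>1 - c\<^sub>2)"
      then have "t * (c\<^sub>1 - c\<^sub>2) \<le> b - N1" using c by (simp add: not_less pos_le_divide_eq)
      then have "h t < 0" unfolding h_def
        using less[of "c\<^sub>2 * t + b" t t] by (simp add: algebra_simps)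
      then show False using that by (simp add: B_def)
    qed
    then have bdd: "bdd_below B" by (meson bdd_belowI less_imp_le)
    have "closed B"
      unfolding B_def using ch by (intro closed_Collect_le) auto
    define T where "T = Inf B"
    have TB: "T \<in> B" unfolding T_def by (rule closed_contains_Inf) fact+
    have before: "h t < 0" if "t < T" for t
      using that cInf_lower[OF _ bdd, of t] by (force simp: B_def T_def)
    have "U\<^sub>1 t x - U\<^sub>2 t x \<le> 0" if "t \<le> T" for t x
    proof (rule continuous_le_on_closure[where S = "{..<T}" and f = "\<lambda>t. U\<^sub>1 t x - U\<^sub>2 t x"])
      show "continuous_on (closure {..<T}) (\<lambda>t. U\<^sub>1 t x - U\<^sub>2 t x)"
        by (intro continuous_intros continuous_on_classical_sol[OF sol1] continuous_on_classical_sol[OF sol2])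
      show "t \<in> closure {..<T}" using that by simp
      show "U\<^sub>1 t x - U\<^sub>2 t x \<le> 0" if "t \<in> {..<T}" for t
        using comp[of t x] before that by simp
    qed
    then have le: "U\<^sub>1 t x \<le> U\<^sub>2 t x" if "t \<le> T" for t x
      using that by simp
    \<comment> \<open>Strict order at the moving point one time unit before the first contact
      propagates to the contact itself.\<close>
    have "U\<^sub>1 (T - 1) (c\<^sub>2 * (T - 1) + b) < U\<^sub>2 (T - 1) (c\<^sub>2 * (T - 1) + b)"
      using before[of "T - 1"] by (simp add: h_def)
    then have "U\<^sub>1 T (c\<^sub>2 * T + b) < U\<^sub>2 T (c\<^sub>2 * T + b)"
      by (rule classical_sol_strict_propagates[OF a(1,2) f(1) sol1 sol2])
        (use le in auto)
    then show False using TB by (simp add: B_def h_def)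
  qed
  moreover have "\<exists>\<tau>. \<forall>t x. U\<^sub>1 t x = U\<^sub>2 (t + \<tau>) x" if c12: "c\<^sub>1 = c\<^sub>2" and c: "c\<^sub>2 \<noteq> 0"
  proof -
    define p where "p = L / \<bar>c\<^sub>2\<bar>"
    have p: "p > 0" using L c by (simp add: p_def)
    have shift: "U\<^sub>1 (t + of_int n * L / c\<^sub>2 + s) (x + of_int n * L) = U\<^sub>1 (t + s) x"
      "U\<^sub>2 (t + of_int n * L / c\<^sub>2) (x + of_int n * L) = U\<^sub>2 t x" for t s x and n :: int
      by (rule traveling_waveD(4)[OF U\<^sub>1] traveling_waveD(4)[OF U\<^sub>2],
          use c c12 in \<open>simp add: field_simps\<close>)+
    define h where "h = (\<lambda>s t. U\<^sub>1 (t + s) (c\<^sub>2 * t + b) - U\<^sub>2 t (c\<^sub>2 * t + b))"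
    have h_shift: "h s (t + of_int n * L / c\<^sub>2) = h s t" for s t and n :: int
    proof -
      have "c\<^sub>2 * (t + of_int n * L / c\<^sub>2) + b = (c\<^sub>2 * t + b) + of_int n * L"
        using c by (simp add: field_simps)
      then show ?thesis by (simp only: h_def shift)
    qed
    have comp: "U\<^sub>1 (t + s) x \<le> U\<^sub>2 t x" if neg: "\<And>t. h s t < 0" for s t x
    proof (rule compare[where A = UNIV and b = b])
      fix \<epsilon> :: real assume "\<epsilon> > 0"
      then obtain Z where Z: "\<And>t x s. \<epsilon> \<le> U\<^sub>1 (t + s) x - U\<^sub>2 t x \<Longrightarrow> Z < x - c\<^sub>2 * t"
        using far_left by blast
      \<comment> \<open>With equal speeds there is no lower bound on time; translations by multiples
        of \<open>(L / c\<^sub>2, L)\<close> move every point into one period instead.\<close>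
      define K where "K = (\<lambda>(t, y). (t, y + c\<^sub>2 * t)) ` ({0..p} \<times> {Z..b})"
      have "\<exists>t' x' n. (t', x') \<in> K \<and> x' = x + of_int n * L \<and> x' - c\<^sub>2 * t' = x - c\<^sub>2 * t \<and>
            U\<^sub>1 (t' + s) x' - U\<^sub>2 t' x' = U\<^sub>1 (t + s) x - U\<^sub>2 t x"
        if tx: "x \<le> c\<^sub>2 * t + b" "\<epsilon> \<le> U\<^sub>1 (t + s) x - U\<^sub>2 t x" for t x
      proof -
        obtain n :: int where n: "t + of_int n * L / c\<^sub>2 \<in> {0..p}"
          using shift_into_period[OF L c] unfolding p_def by blast
        have eq: "x + of_int n * L - c\<^sub>2 * (t + of_int n * L / c\<^sub>2) = x - c\<^sub>2 * t"
          using c by (simp add: field_simps)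
        have "(t + of_int n * L / c\<^sub>2, x + of_int n * L) \<in> K"
          unfolding K_def using n Z[OF tx(2)] tx(1) eq
          by (intro image_eqI[of _ _ "(t + of_int n * L / c\<^sub>2, x - c\<^sub>2 * t)"]) auto
        then show ?thesis using eq shift by metis
      qed
      moreover have "compact K" unfolding K_def by (rule strip)
      moreover have "K \<subseteq> {(t, x). t \<in> UNIV \<and> x \<le> c\<^sub>2 * t + b}" by (auto simp: K_def)
      ultimately show "\<exists>K. compact K \<and> K \<subseteq> {(t, x). t \<in> UNIV \<and> x \<le> c\<^sub>2 * t + b} \<and>
        (\<forall>t x. t \<in> UNIV \<longrightarrow> x \<le> c\<^sub>2 * t + b \<longrightarrow> \<epsilon> \<le> U\<^sub>1 (t + s) x - U\<^sub>2 t x \<longrightarrow>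
        (\<exists>t' x' n. (t', x') \<in> K \<and> x' = x + of_int n * L \<and> x' - c\<^sub>2 * t' = x - c\<^sub>2 * t \<and>
          U\<^sub>1 (t' + s) x' - U\<^sub>2 t' x' = U\<^sub>1 (t + s) x - U\<^sub>2 t x))"
        by blast
    qed (use neg in \<open>auto simp: h_def\<close>)
    \<comment> \<open>With \<open>s0\<close> the first wave has moving coordinate \<open>N1\<close>
      at every moving point, so \<open>less\<close> applies for all t; with \<open>s1\<close> it has
      coordinate \<open>M1\<close> at t = 0, x = N2, so \<open>greater\<close> applies.\<close>
    define s0 where "s0 = (b - N1) / c\<^sub>2"
    define s1 where "s1 = (N2 - M1) / c\<^sub>2"
    have s0: "h s0 t < 0" for t
      unfolding h_def using c less[of "c\<^sub>2 * t + b" "t + s0" t] by (simp add: s0_def c12 field_simps)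
    have s1: "\<exists>t. h s1 t \<ge> 0"
    proof (rule ccontr)
      assume "\<not> (\<exists>t. h s1 t \<ge> 0)"
      then have "U\<^sub>1 (0 + s1) N2 \<le> U\<^sub>2 0 N2" by (intro comp) (auto simp: not_le)
      then show False using greater[of N2 s1 0] c by (simp add: s1_def c12)
    qed
    \<comment> \<open>The parameter \<theta> in [0, 1] avoids distinguishing whether
      \<open>s0\<close> or \<open>s1\<close> is larger.\<close>
    define S where "S = (\<lambda>\<theta>. s0 + \<theta> * (s1 - s0))"
    define B where "B = ({0..1} \<times> {0..p}) \<inter> {z. 0 \<le> h (S (fst z)) (snd z)}"
    \<comment> \<open>Every contact recurs in one period of time, so a compact set of pairs
      (\<theta>, t) suffices and a first contact parameter exists.\<close>
    have reduce: "\<exists>t'\<in>{0..p}. \<forall>s. h s t' = h s t" for t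
      using shift_into_period[OF L c, of t] h_shift unfolding p_def by metis
    have "continuous_on UNIV (\<lambda>z. h (S (fst z)) (snd z))"
      unfolding h_def S_def
      by (intro continuous_intros continuous_on_classical_sol[OF sol1] continuous_on_classical_sol[OF sol2])
    then have "closed {z. 0 \<le> h (S (fst z)) (snd z)}"
      by (intro closed_Collect_le) auto
    then have cB: "compact B"
      unfolding B_def by (intro compact_Int_closed compact_Times) auto
    have neB: "B \<noteq> {}"
    proof -
      obtain t where "t \<in> {0..p}" "h s1 t \<ge> 0" using s1 reduce by metis
      then have "(1, t) \<in> B" by (simp add: B_def S_def)
      then show ?thesis by blast
    qed
    obtain z where z: "z \<in> B" "\<And>z'. z' \<in> B \<Longrightarrow> fst z \<le> fst z'"
      using continuous_attains_inf[OF cB neB continuous_on_fst[OF continuous_on_id]] by auto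
    obtain \<theta> T where z_eq: "z = (\<theta>, T)" by fastforce
    have \<theta>: "0 \<le> \<theta>" "\<theta> \<le> 1" and T: "h (S \<theta>) T \<ge> 0" using z(1) by (auto simp: z_eq B_def)
    have "\<theta> \<noteq> 0" using T s0[of T] by (auto simp: S_def)
    then have "\<theta> > 0" using \<theta> by simp
    have before: "h (S \<theta>') t < 0" if "0 \<le> \<theta>'" "\<theta>' < \<theta>" for \<theta>' t
    proof (rule ccontr)
      assume "\<not> h (S \<theta>') t < 0"
      then obtain t' where "t' \<in> {0..p}" "h (S \<theta>') t' \<ge> 0" using reduce by (metis not_le)
      then have "(\<theta>', t') \<in> B" using that \<theta> by (simp add: B_def)
      then show False using z(2) that by (fastforce simp: z_eq)
    qed
    define \<sigma> where "\<sigma> = S \<theta>"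
    have le: "U\<^sub>1 (t + \<sigma>) x - U\<^sub>2 t x \<le> 0" for t x
      unfolding \<sigma>_def
    proof (rule continuous_le_on_closure[where S = "{0..<\<theta>}" and f = "\<lambda>\<theta>. U\<^sub>1 (t + S \<theta>) x - U\<^sub>2 t x"])
      show "continuous_on (closure {0..<\<theta>}) (\<lambda>\<theta>. U\<^sub>1 (t + S \<theta>) x - U\<^sub>2 t x)"
        unfolding S_def
        by (intro continuous_intros continuous_on_classical_sol[OF sol1] continuous_on_classical_sol[OF sol2])
      show "\<theta> \<in> closure {0..<\<theta>}" using \<open>\<theta> > 0\<close> by simp
      show "U\<^sub>1 (t + S \<theta>') x - U\<^sub>2 t x \<le> 0" if "\<theta>' \<in> {0..<\<theta>}" for \<theta>'
        using comp[OF before] that by simp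
    qed
    \<comment> \<open>A strict inequality anywhere before time \<open>T\<close> would propagate to
      the contact at the moving point.\<close>
    have eq: "U\<^sub>1 (t + \<sigma>) x = U\<^sub>2 t x" if "t < T" for t x
    proof (rule ccontr)
      assume "U\<^sub>1 (t + \<sigma>) x \<noteq> U\<^sub>2 t x"
      then have "U\<^sub>1 (t + \<sigma>) x < U\<^sub>2 t x" using le[of t x] by simp
      then have "U\<^sub>1 (T + \<sigma>) (c\<^sub>2 * T + b) < U\<^sub>2 T (c\<^sub>2 * T + b)"
        by (rule classical_sol_strict_propagates[OF a(1,2) f(1) classical_sol_shift[OF sol1] sol2])
          (use le that in auto)
      then show False using T by (simp add: h_def \<sigma>_def)
    qed
    have eq_all: "U\<^sub>1 (t + \<sigma>) x = U\<^sub>2 t x" for t x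
    proof -
      \<comment> \<open>Translation by \<open>n\<close> periods, with the sign of n adapted to that
        of \<open>c\<^sub>2\<close>, moves time back by k p, below \<open>T\<close>, where the waves
        agree.\<close>
      obtain k :: nat where k: "t - T < of_nat k * p" using ex_less_of_nat_mult[OF p] by blast
      define n where "n = (if c\<^sub>2 > 0 then - int k else int k)"
      have "of_int n * L / c\<^sub>2 = - (of_nat k * p)" using c by (simp add: n_def p_def)
      then have "t + of_int n * L / c\<^sub>2 < T" using k by simp
      from eq[OF this, of "x + of_int n * L"] show ?thesis by (simp only: shift)
    qed
    show ?thesis
      using eq_all[of "t - \<sigma>" for t] by (intro exI[of _ "- \<sigma>"]) simp
  qed
  ultimately show ?thesis by blast
qed

end
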